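(* Let $t_f>0$, let $\ell$ be the line in $\mathbb{R}^3$ through $\boldsymbol{x}_0$ with direction $\boldsymbol{y}_0$, and let $P$ be any plane in $\mathbb{R}^3$ containing $\ell$. Then the three-dimensional position reachability set $\pi_3(\mathcal{G}_3(t_f))\subseteq\mathbb{R}^3$ is exactly the set obtained by rotating the planar position reachability set $\pi_2(\mathcal{G}_2(t_f))\subseteq P$ around $\ell$ (the axis of the initial velocity vector); that is, $\pi_3(\mathcal{G}_3(t_f))=\bigcup_{R}R\big(\pi_2(\mathcal{G}_2(t_f))\big)$, where $R$ ranges over all rotations of $\mathbb{R}^3$ about the axis $\ell$.
   Context: Dynamics. Consider the control system $\dot{\boldsymbol{x}}=\boldsymbol{y}$, $\dot{\boldsymbol{y}}=\boldsymbol{y}\times\boldsymbol{w}$, with $\boldsymbol{x}(t)\in\mathbb{R}^3$, $\boldsymbol{y}(t)\in\mathbb{S}^2$ (unit sphere), $\boldsymbol{w}(t)\in\mathbb{B}^3$ (closed unit ball of $\mathbb{R}^3$), and fixed initial condition $\boldsymbol{x}(0)=\boldsymbol{x}_0\in\mathbb{R}^3$, $\boldsymbol{y}(0)=\boldsymbol{y}_0\in\mathbb{S}^2$. Admissible controls are all measurable functions $t\mapsto\boldsymbol{w}(t)\in\mathbb{B}^3$; trajectories are absolutely continuous. The curves $t\mapsto\boldsymbol{x}(t)$ are the arc-length parametrized curves with absolutely continuous velocity and curvature bound $1$ (the maximum curvature is normalized to $1$). $\mathcal{G}_3(t)$ is the set of all states $(\boldsymbol{x}(t),\boldsymbol{y}(t))$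 obtained at time $t$ from admissible controls, and $\pi_3(\boldsymbol{x},\boldsymbol{y})=\boldsymbol{x}$; thus $\pi_3(\mathcal{G}_3(t_f))$ is the set of endpoints $\boldsymbol{x}(t_f)$ of all such curves of length $t_f$. Planar counterpart (Dubins car). $\mathcal{G}_2(t)$ is the set of states at time $t$ of $\dot{x}^1=\cos\theta$, $\dot{x}^2=\sin\theta$, $\dot\theta=u$, with measurable $u$, $|u|\le 1$, and fixed initial state, and $\pi_2(x^1,x^2,\theta)=(x^1,x^2)$. The plane $P$ is taken as the ambient plane in place of $\mathbb{R}^2$, with initial point $\boldsymbol{x}_0$ and initial direction $\boldsymbol{y}_0$: that is, $\pi_2(\mathcal{G}_2(t_f))\subseteq P$ denotes the set of endpoints $\boldsymbol{x}(t_f)$ of all curves of length $t_f$, with curvature bound $1$, $\boldsymbol{x}(0)=\boldsymbol{x}_0$ and $\dot{\boldsymbol{x}}(0)=\boldsymbol{y}_0$, that lie entirely in $P$. *)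

theory Defs
  imports "HOL-Analysis.Analysis"
begin

text \<open>
  The usual epsilon-delta notion for functions on a set of reals. A division consists of finitely
  many compact intervals with pairwise disjoint interiors; the union of the intervals is only
  required to lie in the set, so it may have gaps.
\<close>

definition absolutely_continuous_on :: "real set \<Rightarrow> (real \<Rightarrow> 'a::real_normed_vector) \<Rightarrow> bool" where
  "absolutely_continuous_on S f \<longleftrightarrow>
     (\<forall>\<epsilon>>0. \<exists>\<delta>>0. \<forall>D. D division_of \<Union>D \<and> \<Union>D \<subseteq> S \<and> (\<Sum>k\<in>D. Sup k - Inf k) < \<delta> \<longrightarrow>
        (\<Sum>k\<in>D. norm (f (Sup k) - f (Inf k))) < \<epsilon>)"

definition admissible_control :: "real \<Rightarrow> (real \<Rightarrow> real^3) \<Rightarrow> bool" where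
  "admissible_control T w \<longleftrightarrow>
     w \<in> borel_measurable (lebesgue_on {0..T}) \<and> (\<forall>t\<in>{0..T}. w t \<in> cball 0 1)"

definition trajectory ::
  "real^3 \<Rightarrow> real^3 \<Rightarrow> real \<Rightarrow> (real \<Rightarrow> real^3) \<Rightarrow> (real \<Rightarrow> real^3) \<Rightarrow> (real \<Rightarrow> real^3) \<Rightarrow> bool" where
  "trajectory x0 y0 T w x y \<longleftrightarrow>
     absolutely_continuous_on {0..T} x \<and> absolutely_continuous_on {0..T} y \<and>
     (\<forall>t\<in>{0..T}. y t \<in> sphere 0 1) \<and>
     x 0 = x0 \<and> y 0 = y0 \<and>
     (AE t in lebesgue_on {0..T}.
        (x has_vector_derivative y t) (at t within {0..T}) \<and>
        (y has_vector_derivative cross3 (y t) (w t)) (at t within {0..T}))"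

definition \<G>\<^sub>3 :: "real^3 \<Rightarrow> real^3 \<Rightarrow> real \<Rightarrow> ((real^3) \<times> (real^3)) set" where
  "\<G>\<^sub>3 x0 y0 T = {(x T, y T) | x y w. admissible_control T w \<and> trajectory x0 y0 T w x y}"

text \<open>
  Arc-length parametrized curves \<open>x\<close> of length \<open>T\<close> with absolutely continuous velocity \<open>y\<close> and
  curvature at most 1.
\<close>

definition curvature_bounded_curve ::
  "real^3 \<Rightarrow> real^3 \<Rightarrow> real \<Rightarrow> (real \<Rightarrow> real^3) \<Rightarrow> (real \<Rightarrow> real^3) \<Rightarrow> bool" where
  "curvature_bounded_curve x0 y0 T x y \<longleftrightarrow>
     (\<forall>t\<in>{0..T}. (x has_vector_derivative y t) (at t within {0..T})) \<and>
     (\<forall>t\<in>{0..T}. norm (y t) = 1) \<and>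
     absolutely_continuous_on {0..T} y \<and>
     (AE t in lebesgue_on {0..T}.
        \<exists>a. (y has_vector_derivative a) (at t within {0..T}) \<and> norm a \<le> 1) \<and>
     x 0 = x0 \<and> y 0 = y0"

text \<open>
  The planar reachable set, with the plane \<open>P\<close> inside three-space as the ambient plane. A planar
  state is recorded as position and unit velocity; the velocity is \<open>(cos \<theta>, sin \<theta>)\<close> in an
  orthonormal frame of the direction space of \<open>P\<close>, and the signed curvature is the Dubins
  control \<open>u\<close>.
\<close>

definition \<G>\<^sub>2 :: "(real^3) set \<Rightarrow> real^3 \<Rightarrow> real^3 \<Rightarrow> real \<Rightarrow> ((real^3) \<times> (real^3)) set" where
  "\<G>\<^sub>2 P x0 y0 T =
     {(x T, y T) | x y. curvature_bounded_curve x0 y0 T x y \<and> (\<forall>t\<in>{0..T}. x t \<in> P)}"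

definition line_through :: "real^3 \<Rightarrow> real^3 \<Rightarrow> (real^3) set" where
  "line_through p v = range (\<lambda>s. p + s *\<^sub>R v)"

definition plane :: "(real^3) set \<Rightarrow> bool" where
  "plane P \<longleftrightarrow> affine P \<and> aff_dim P = 2"

text \<open>The orientation-preserving isometries that fix \<open>L\<close> pointwise.\<close>

definition rotations_about :: "(real^3) set \<Rightarrow> (real^3 \<Rightarrow> real^3) set" where
  "rotations_about L =
     {R. (\<exists>A b. rotation_matrix A \<and> R = (\<lambda>p. A *v p + b)) \<and> (\<forall>p\<in>L. R p = p)}"

end

theory Submission
  imports Defs
begin

text \<open>
  The inclusion from right to left is immediate: a rotation about the axis maps a curve of bounded
  curvature in \<open>P\<close> to another curve with the same initial data, and every such curve is a trajectory of
  the control system for the control \<open>cross3 a y\<close>, where \<open>a\<close> is the acceleration and \<open>y\<close> the velocity.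

  For the other inclusion it suffices to find, for a given curve in space with end point \<open>X\<close>, a planar
  curve of the same length, with curvature at most one, whose displacement has the same norm and makes
  the same angle with the initial velocity. Such a curve is obtained by a classical construction: develop
  into the plane the cone with apex \<open>X\<close> over the curve. The development preserves arc length, the
  distance to the apex and the angle between the velocity and the ray to the apex. It does not
  increase the curvature, because the curvature of the developed curve is the geodesic curvature of the
  original curve in the cone. As the apex is the end point itself, the developed curve ends at its
  apex, which gives both conditions on the displacement at once.

  In complex notation the development solves a linear differential equation. If \<open>W\<close> is the vector to the
  apex, \<open>p\<close> its inner product with the unit velocity \<open>y\<close>, and \<open>q\<close> the norm of its component orthogonal to
  \<open>y\<close>, then the developed vector \<open>w\<close> satisfies \<open>w' = - w * (p + \<i> * q) / (norm W)\<^sup>2\<close>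
  (\<open>development_away_from_apex\<close>). This is singular when the curve passes through \<open>X\<close>. The developed velocity
  is Lipschitz with constant one and so extends to the end points of an interval on which the curve avoids
  \<open>X\<close> (\<open>development_simple\<close>), and a curve that visits \<open>X\<close> earlier is cut into finitely many pieces,
  since a closed loop has length at least one (\<open>planar_development\<close>).

  All regularity is of Lipschitz type: an absolutely continuous function whose derivative is
  bounded by \<open>B\<close> almost everywhere is Lipschitz with constant \<open>B\<close>
  (\<open>absolutely_continuous_imp_lipschitz\<close>).
\<close>

section \<open>Absolutely continuous and Lipschitz functions on the line\<close>

lemma has_vector_derivative_at_eps:
  fixes f :: "real \<Rightarrow> 'a::real_normed_vector"
  assumes "(f has_vector_derivative f') (at t)" and "e > 0"
  obtains r where "r > 0" and "\<And>s. \<bar>s - t\<bar> < r \<Longrightarrow> norm (f s - f t - (s - t) *\<^sub>R f') \<le> e * \<bar>s - t\<bar>"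
  using assms unfolding has_vector_derivative_def has_derivative_at_alt real_norm_def by meson

text \<open>
  A tagged division of \<open>{u..v}\<close> is chosen so fine that every interval tagged at a point of
  differentiability contributes at most \<open>B\<close> times its length, up to a small relative error, while the
  intervals tagged in the exceptional set lie inside an open set of small measure; absolute
  continuity makes the total contribution of the latter small.
\<close>

lemma absolutely_continuous_imp_lipschitz:
  fixes f :: "real \<Rightarrow> 'a::real_normed_vector"
  assumes ac: "absolutely_continuous_on {a..b} f"
    and N: "negligible N" and B: "0 \<le> B"
    and deriv: "\<And>t. t \<in> {a<..<b} - N \<Longrightarrow> \<exists>f'. (f has_vector_derivative f') (at t) \<and> norm f' \<le> B"
  shows "B-lipschitz_on {a..b} f"
proof (rule lipschitz_on_leI[OF _ B])
  fix u v assume uv: "u \<in> {a..b}" "v \<in> {a..b}" "u \<le> v"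
  have "norm (f v - f u) \<le> B * (v - u)"
  proof (rule field_le_epsilon)
    fix e :: real assume "e > 0"
    define e1 where "e1 = e / (2 * (v - u + 1))"
    have e1: "e1 > 0" "e1 * (v - u) \<le> e / 2"
      using \<open>e > 0\<close> uv by (auto simp: e1_def field_simps)
    obtain \<delta> where \<delta>: "\<delta> > 0" and small: "\<And>D. \<lbrakk>D division_of \<Union>D; \<Union>D \<subseteq> {a..b}; 
        (\<Sum>k\<in>D. Sup k - Inf k) < \<delta>\<rbrakk> \<Longrightarrow> (\<Sum>k\<in>D. norm (f (Sup k) - f (Inf k))) < e / 2"
      using ac \<open>e > 0\<close> unfolding absolutely_continuous_on_def by (meson half_gt_zero)
    \<comment> \<open>The endpoints join the exceptional set, as a two-sided derivative is only given in the interior.\<close>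
    define M where "M = N \<union> {a, b}"
    have "negligible M" using N by (simp add: M_def negligible_Un)
    then have M: "M \<in> lmeasurable" "measure lebesgue M = 0"
      by (auto simp: negligible_iff_measure)
    obtain U where U: "open U" "M \<subseteq> U" "U - M \<in> lmeasurable" "emeasure lebesgue (U - M) < ennreal \<delta>"
      using sets_lebesgue_outer_open[OF fmeasurableD[OF M(1)] \<delta>] by metis
    have UM: "U \<in> lmeasurable" 
      using fmeasurable.Un[OF U(3) M(1)] U(2) by (simp add: Un_absorb2)
    have "measure lebesgue (U - M) < \<delta>"
      using U \<delta> by (simp add: emeasure_eq_measure2 ennreal_less_iff)
    moreover have "measure lebesgue U = measure lebesgue (U - M)"
      using M U UM by (simp add: measurable_measure_Diff)
    ultimately have mU: "measure lebesgue U < \<delta>" by simp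
    have "\<exists>r>0. (t \<in> M \<longrightarrow> ball t r \<subseteq> U) \<and>
        (t \<in> {a..b} - M \<longrightarrow> (\<exists>f'. norm f' \<le> B \<and> (\<forall>s. \<bar>s - t\<bar> < r \<longrightarrow> norm (f s - f t - (s - t) *\<^sub>R f') \<le> e1 * \<bar>s - t\<bar>)))" for t
    proof (cases "t \<in> M")
      case True
      then show ?thesis using U by (meson Diff_iff openE subsetD)
    next
      case False
      show ?thesis
      proof (cases "t \<in> {a..b}")
        case True
        with False have "t \<in> {a<..<b} - N" by (auto simp: M_def less_le)
        then obtain f' where "(f has_vector_derivative f') (at t)" "norm f' \<le> B" using deriv by blast
        moreover from this(1) obtain r where "r > 0"
            "\<And>s. \<bar>s - t\<bar> < r \<Longrightarrow> norm (f s - f t - (s - t) *\<^sub>R f') \<le> e1 * \<bar>s - t\<bar>"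
          using has_vector_derivative_at_eps[OF _ e1(1)] by blast
        ultimately show ?thesis using False by blast
      qed (use False in \<open>auto intro: exI[of _ 1]\<close>)
    qed
    then obtain r where r: "\<And>t. r t > 0" "\<And>t. t \<in> M \<Longrightarrow> ball t (r t) \<subseteq> U"
      "\<And>t. t \<in> {a..b} - M \<Longrightarrow> \<exists>f'. norm f' \<le> B \<and> (\<forall>s. \<bar>s - t\<bar> < r t \<longrightarrow> norm (f s - f t - (s - t) *\<^sub>R f') \<le> e1 * \<bar>s - t\<bar>)"
      by metis
    obtain p where p: "p tagged_division_of {u..v}" and fine: "(\<lambda>t. ball t (r t)) fine p"
      by (rule fine_division_exists_real[OF gauge_ball_dependent[of r]]) (use r(1) in auto)
    have finp: "finite p" using p by (rule tagged_division_ofD)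
    have interval: "\<exists>c d. k = {c..d} \<and> c \<le> x \<and> x \<le> d \<and> u \<le> c \<and> d \<le> v" if xk: "(x, k) \<in> p" for x k
    proof -
      obtain c d where "k = {c..d}" using tagged_division_ofD(4)[OF p xk] by auto
      moreover have "x \<in> k" "k \<subseteq> {u..v}" using tagged_division_ofD(2,3)[OF p xk] by auto
      ultimately show ?thesis by fastforce
    qed
    define q where "q = {z \<in> p. fst z \<in> M}"
    have qp: "q \<subseteq> p" "finite q" using finp by (auto simp: q_def)
    have "q tagged_partial_division_of {u..v}"
      using p qp(1) by (meson tagged_division_of_def tagged_partial_division_subset)
    then have qtd: "q tagged_division_of \<Union>(snd ` q)"
      by (rule tagged_partial_division_of_Union_self)
    then have qd: "snd ` q division_of \<Union>(snd ` q)"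
      by (rule division_of_tagged_division)
    have len: "measure lebesgue k = Sup k - Inf k" if "k \<in> snd ` q" for k
      using interval qp that by force
    \<comment> \<open>The empty set gets the value zero since \<open>Sup {}\<close> and \<open>Inf {}\<close> are unspecified reals.\<close>
    define d where "d k = (if k = {} then 0 else norm (f (Sup k) - f (Inf k)))" for k
    have "d (cbox c c') = 0" if "box c c' = {}" for c c'
      using that by (auto simp: d_def)
    then have "(\<Sum>(x,k)\<in>q. d k) = (\<Sum>k\<in>snd ` q. d k)"
      by (rule sum.over_tagged_division_lemma[OF qtd])
    moreover have "d k = norm (f (Sup k) - f (Inf k))" if "(x, k) \<in> q" for x k
      using interval that qp by (fastforce simp: d_def)
    ultimately have "(\<Sum>(x,k)\<in>q. norm (f (Sup k) - f (Inf k))) = (\<Sum>k\<in>snd ` q. norm (f (Sup k) - f (Inf k)))"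
      by (smt (verit, best) imageE prod.collapse split_beta sum.cong)
    also have "\<dots> < e / 2"
    proof (rule small[OF qd])
      show "\<Union>(snd ` q) \<subseteq> {a..b}" using interval qp uv by force
      have "(\<Sum>k\<in>snd ` q. Sup k - Inf k) = measure lebesgue (\<Union>(snd ` q))"
        by (subst content_division[OF qd, symmetric]) (simp add: len del: imageE)
      also have "\<dots> \<le> measure lebesgue U"
      proof (rule measure_mono_fmeasurable[OF _ _ UM])
        show "\<Union>(snd ` q) \<subseteq> U"
          using fine qp r(2) unfolding fine_def q_def by fastforce
        show "\<Union>(snd ` q) \<in> sets lebesgue"
          using qd by (meson fmeasurableD lmeasurable_division)
      qed
      finally show "(\<Sum>k\<in>snd ` q. Sup k - Inf k) < \<delta>" using mU by simp
    qed
    finally have bad: "(\<Sum>(x,k)\<in>q. norm (f (Sup k) - f (Inf k))) < e / 2" .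
    have good: "norm (f (Sup k) - f (Inf k)) \<le> (B + e1) * (Sup k - Inf k)" if xk: "(x, k) \<in> p - q" for x k
    proof -
      obtain c d where cd: "k = {c..d}" "c \<le> x" "x \<le> d" "u \<le> c" "d \<le> v" using interval xk by blast
      have "x \<in> {a..b} - M" using cd xk uv by (auto simp: q_def)
      then obtain f' where f': "norm f' \<le> B"
        "\<And>s. \<bar>s - x\<bar> < r x \<Longrightarrow> norm (f s - f x - (s - x) *\<^sub>R f') \<le> e1 * \<bar>s - x\<bar>"
        using r(3) by blast
      have "k \<subseteq> ball x (r x)" using fine xk unfolding fine_def by fastforce
      moreover have "c \<in> k" "d \<in> k" using cd by auto
      ultimately have "c \<in> ball x (r x)" "d \<in> ball x (r x)" by auto
      then have 1: "norm (f c - f x - (c - x) *\<^sub>R f') \<le> e1 * (x - c)" "norm (f d - f x - (d - x) *\<^sub>R f') \<le> e1 * (d - x)"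
        using f'(2)[of c] f'(2)[of d] cd by (auto simp: dist_real_def)
      have "f d - f c = (f d - f x - (d - x) *\<^sub>R f') - (f c - f x - (c - x) *\<^sub>R f') + (d - c) *\<^sub>R f'"
        by (simp add: algebra_simps)
      also have "norm \<dots> \<le> e1 * (d - x) + e1 * (x - c) + (d - c) * B"
      proof (rule order_trans[OF norm_triangle_ineq add_mono[OF order_trans[OF norm_triangle_ineq4 add_mono[OF 1(2,1)]]]])
        show "norm ((d - c) *\<^sub>R f') \<le> (d - c) * B" using f'(1) cd by (simp add: mult_left_mono)
      qed
      finally show ?thesis using cd by (simp add: algebra_simps)
    qed
    have "f v - f u = (\<Sum>(x,k)\<in>p. f (Sup k) - f (Inf k))"
      by (rule additive_tagged_division_1[OF uv(3) p, symmetric])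
    also have "norm \<dots> \<le> (\<Sum>(x,k)\<in>p. norm (f (Sup k) - f (Inf k)))"
      by (rule sum_norm_le) auto
    also have "\<dots> = (\<Sum>(x,k)\<in>p - q. norm (f (Sup k) - f (Inf k))) + (\<Sum>(x,k)\<in>q. norm (f (Sup k) - f (Inf k)))"
      by (rule sum.subset_diff[OF qp(1) finp])
    also have "\<dots> \<le> (\<Sum>(x,k)\<in>p - q. (B + e1) * (Sup k - Inf k)) + e / 2"
      using bad good by (intro add_mono sum_mono) (auto simp: split_beta)
    also have "(\<Sum>(x,k)\<in>p - q. (B + e1) * (Sup k - Inf k)) \<le> (\<Sum>(x,k)\<in>p. (B + e1) * (Sup k - Inf k))"
      by (rule sum_mono2[OF finp]) (use qp B e1 interval in force)+
    also have "\<dots> = (B + e1) * (\<Sum>(x,k)\<in>p. Sup k - Inf k)"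
      by (simp add: sum_distrib_left split_beta)
    also have "(\<Sum>(x,k)\<in>p. Sup k - Inf k) = v - u"
      by (rule additive_tagged_division_1[OF uv(3) p])
    finally show "norm (f v - f u) \<le> B * (v - u) + e" using e1 by (simp add: algebra_simps)
  qed
  then show "dist (f u) (f v) \<le> B * dist u v"
    using uv by (simp add: dist_norm norm_minus_commute)
qed

lemma lipschitz_imp_absolutely_continuous:
  assumes "C-lipschitz_on S f"
  shows "absolutely_continuous_on S f"
  unfolding absolutely_continuous_on_def
proof (intro allI impI)
  fix e :: real assume "e > 0"
  have C: "C \<ge> 0" using assms by (rule lipschitz_on_nonneg)
  have "(\<Sum>k\<in>D. norm (f (Sup k) - f (Inf k))) < e"
    if D: "D division_of \<Union>D" "\<Union>D \<subseteq> S" "(\<Sum>k\<in>D. Sup k - Inf k) < e / (C + 1)" for D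
  proof -
    have "(\<Sum>k\<in>D. norm (f (Sup k) - f (Inf k))) \<le> (\<Sum>k\<in>D. C * (Sup k - Inf k))"
    proof (rule sum_mono)
      fix k assume k: "k \<in> D"
      then obtain c d where cd: "k = {c..d}" "c \<le> d"
        using division_ofD(3,4)[OF D(1) k] by auto
      then have "{c, d} \<subseteq> k" by auto
      then have "{c, d} \<subseteq> S" using D(2) k by blast
      then show "norm (f (Sup k) - f (Inf k)) \<le> C * (Sup k - Inf k)"
        using lipschitz_on_normD[OF assms, of d c] cd by simp
    qed
    also have "\<dots> \<le> C * (e / (C + 1))"
      unfolding sum_distrib_left[symmetric] by (rule mult_left_mono[OF less_imp_le[OF D(3)] C])
    also have "\<dots> < e" using \<open>e > 0\<close> C by (simp add: field_simps)
    finally show ?thesis .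
  qed
  then show "\<exists>\<delta>>0. \<forall>D. D division_of \<Union>D \<and> \<Union>D \<subseteq> S \<and> (\<Sum>k\<in>D. Sup k - Inf k) < \<delta> \<longrightarrow>
      (\<Sum>k\<in>D. norm (f (Sup k) - f (Inf k))) < e"
    using \<open>e > 0\<close> C by (intro exI[of _ "e / (C + 1)"]) auto
qed

lemma countable_isolated_points:
  fixes S :: "'a::second_countable_topology set"
  shows "countable {t. t isolated_in S}"
proof -
  obtain \<B> :: "'a set set" where \<B>: "countable \<B>" "topological_basis \<B>"
    using ex_countable_basis by blast
  have "\<exists>V\<in>\<B>. V \<inter> S = {t}" if t: "t isolated_in S" for t
  proof -
    obtain T where T: "open T" "T \<inter> S = {t}" using t by (auto simp: isolated_in_def)
    then obtain V where "V \<in> \<B>" "t \<in> V" "V \<subseteq> T"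
      using topological_basisE[OF \<B>(2), of T t] by blast
    then show ?thesis using T by blast
  qed
  then have "\<exists>V. \<forall>t\<in>{t. t isolated_in S}. V t \<in> \<B> \<and> V t \<inter> S = {t}"
    by (intro bchoice) blast
  then obtain V where V: "\<And>t. t isolated_in S \<Longrightarrow> V t \<in> \<B> \<and> V t \<inter> S = {t}" by blast
  then have "inj_on V {t. t isolated_in S}" by (intro inj_onI) (metis mem_Collect_eq singleton_inject)
  moreover have "V ` {t. t isolated_in S} \<subseteq> \<B>" using V by blast
  ultimately show ?thesis using \<B>(1) by (meson countable_image_inj_on countable_subset)
qed

text \<open>
  A zero with non-vanishing derivative is isolated in the zero set. This is what makes the norm of
  an almost everywhere differentiable vector function differentiable almost everywhere: at the
  remaining zeros the derivative vanishes, and so does the derivative of the norm.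
\<close>

lemma countable_transversal_zeros:
  fixes g :: "real \<Rightarrow> 'a::real_normed_vector"
  shows "countable {t. g t = 0 \<and> (\<exists>g'. (g has_vector_derivative g') (at t) \<and> g' \<noteq> 0)}"
proof (rule countable_subset[OF _ countable_isolated_points])
  show "{t. g t = 0 \<and> (\<exists>g'. (g has_vector_derivative g') (at t) \<and> g' \<noteq> 0)} \<subseteq> {t. t isolated_in {t. g t = 0}}"
  proof clarify
    fix t g' assume t: "g t = 0" "(g has_vector_derivative g') (at t)" "g' \<noteq> 0"
    then have "norm g' / 2 > 0" by simp
    then obtain r where r: "r > 0" "\<And>s. \<bar>s - t\<bar> < r \<Longrightarrow> norm (g s - g t - (s - t) *\<^sub>R g') \<le> norm g' / 2 * \<bar>s - t\<bar>"
      using has_vector_derivative_at_eps[OF t(2)] by metis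
    have "s = t" if "g s = 0" "dist t s < r" for s
    proof -
      have "norm g' * \<bar>s - t\<bar> \<le> 0"
        using r(2)[of s] that t by (auto simp: dist_real_def abs_minus_commute)
      then show ?thesis using t(3) by (simp add: mult_le_0_iff)
    qed
    then show "t isolated_in {t. g t = 0}"
      using r(1) t(1) unfolding isolated_in_dist_Ex_iff by blast
  qed
qed

section \<open>Developing a curve away from the apex\<close>

lemma bilinear_lipschitz_on_compact:
  fixes f :: "'m::metric_space \<Rightarrow> 'a::real_normed_vector" and g :: "'m \<Rightarrow> 'b::real_normed_vector"
    and mul :: "'a \<Rightarrow> 'b \<Rightarrow> 'c::real_normed_vector"
  assumes "bounded_bilinear mul" and "compact S"
    and f: "\<exists>C. C-lipschitz_on S f" and g: "\<exists>C. C-lipschitz_on S g"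
  shows "\<exists>C. C-lipschitz_on S (\<lambda>t. mul (f t) (g t))"
proof -
  interpret bounded_bilinear mul by fact
  obtain F G where FG: "F-lipschitz_on S f" "G-lipschitz_on S g" using f g by blast
  have "bounded (f ` S)" "bounded (g ` S)"
    using FG \<open>compact S\<close> by (auto intro!: compact_imp_bounded compact_continuous_image lipschitz_on_continuous_on)
  then obtain A B where AB: "\<And>t. t \<in> S \<Longrightarrow> norm (f t) \<le> A" "\<And>t. t \<in> S \<Longrightarrow> norm (g t) \<le> B" "A > 0" "B > 0"
    by (auto simp: bounded_pos)
  obtain K where K: "K \<ge> 0" "\<And>u v. norm (mul u v) \<le> norm u * norm v * K"
    using nonneg_bounded by blast
  have FG0: "F \<ge> 0" "G \<ge> 0" using FG lipschitz_on_nonneg by blast+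
  have "(A * G * K + F * B * K)-lipschitz_on S (\<lambda>t. mul (f t) (g t))"
  proof (rule lipschitz_onI)
    fix s t assume st: "s \<in> S" "t \<in> S"
    have "mul (f s) (g s) - mul (f t) (g t) = mul (f s) (g s - g t) + mul (f s - f t) (g t)"
      by (simp add: diff_left diff_right)
    also have "norm \<dots> \<le> norm (f s) * norm (g s - g t) * K + norm (f s - f t) * norm (g t) * K"
      by (rule order_trans[OF norm_triangle_ineq add_mono[OF K(2) K(2)]])
    also have "\<dots> \<le> A * (G * dist s t) * K + (F * dist s t) * B * K"
      using st AB K FG0 lipschitz_onD[OF FG(1) st] lipschitz_onD[OF FG(2) st]
      by (intro add_mono mult_mono) (auto simp: dist_norm)
    finally show "dist (mul (f s) (g s)) (mul (f t) (g t)) \<le> (A * G * K + F * B * K) * dist s t"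
      by (simp add: dist_norm algebra_simps)
  qed (use AB K FG0 in simp)
  then show ?thesis by blast
qed

lemma C1_lipschitz_on_compact:
  fixes f :: "real \<Rightarrow> 'a::real_normed_vector"
  assumes deriv: "\<And>t. t \<in> {c..d} \<Longrightarrow> (f has_vector_derivative f' t) (at t)" and cont: "continuous_on {c..d} f'"
  shows "\<exists>C. C-lipschitz_on {c..d} f"
proof -
  have "bounded (f' ` {c..d})" using cont by (intro compact_imp_bounded compact_continuous_image) auto
  then obtain B where B: "B > 0" "\<And>t. t \<in> {c..d} \<Longrightarrow> norm (f' t) \<le> B" by (auto simp: bounded_pos)
  have "B-lipschitz_on {c..d} f"
  proof (rule bounded_derivative_imp_lipschitz)
    fix t assume t: "t \<in> {c..d}"
    show "(f has_derivative (\<lambda>h. h *\<^sub>R f' t)) (at t within {c..d})"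
      using deriv[OF t] by (auto simp: has_vector_derivative_def intro: has_derivative_at_withinI)
    show "onorm (\<lambda>h. h *\<^sub>R f' t) \<le> B"
    proof (rule onorm_bound)
      show "norm (h *\<^sub>R f' t) \<le> B * norm h" for h
        using mult_right_mono[OF B(2)[OF t], of "\<bar>h\<bar>"] by (simp add: mult.commute)
    qed (use B in auto)
  qed (use B in auto)
  then show ?thesis by blast
qed

lemma lipschitz_norm: "C-lipschitz_on S f \<Longrightarrow> C-lipschitz_on S (\<lambda>t. norm (f t))"
  unfolding lipschitz_on_def dist_norm by (smt (verit, best) norm_triangle_ineq3 real_norm_def)

lemma vector_derivative_norm_le_lipschitz:
  fixes f :: "real \<Rightarrow> 'a::real_normed_vector"
  assumes lip: "C-lipschitz_on S f" and "open S" "t \<in> S" and f': "(f has_vector_derivative f') (at t)"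
  shows "norm f' \<le> C"
proof (rule field_le_epsilon)
  fix e :: real assume "e > 0"
  obtain r where r: "r > 0" "\<And>s. \<bar>s - t\<bar> < r \<Longrightarrow> norm (f s - f t - (s - t) *\<^sub>R f') \<le> e * \<bar>s - t\<bar>"
    using has_vector_derivative_at_eps[OF f' \<open>e > 0\<close>] by metis
  obtain r' where r': "r' > 0" "ball t r' \<subseteq> S" using \<open>open S\<close> \<open>t \<in> S\<close> openE by blast
  define h where "h = min r r' / 2"
  have h: "0 < h" "h < r" "h < r'" using r(1) r'(1) by (auto simp: h_def min_def)
  then have "t + h \<in> S" using r'(2) by (auto simp: dist_real_def subset_iff)
  then have "norm (f (t + h) - f t) \<le> C * h"
    using lipschitz_on_normD[OF lip _ \<open>t \<in> S\<close>, of "t + h"] h by simp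
  moreover have "norm (f (t + h) - f t - h *\<^sub>R f') \<le> e * h" using r(2)[of "t + h"] h by simp
  ultimately have "norm (h *\<^sub>R f') \<le> C * h + e * h"
    using norm_triangle_ineq4[of "f (t + h) - f t" "f (t + h) - f t - h *\<^sub>R f'"] by simp
  then have "h * norm f' \<le> h * (C + e)" using h by (simp add: algebra_simps)
  then show "norm f' \<le> C + e" using h by simp
qed

lemma unit_speed_derivative_orthogonal:
  fixes y :: "real \<Rightarrow> 'a::real_inner"
  assumes "open S" "t \<in> S" and "\<And>s. s \<in> S \<Longrightarrow> norm (y s) = 1" and y': "(y has_vector_derivative z) (at t)"
  shows "y t \<bullet> z = 0"
proof -
  have "((\<lambda>s. y s \<bullet> y s) has_vector_derivative (y t \<bullet> z + z \<bullet> y t)) (at t)"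
    by (rule bounded_bilinear.has_vector_derivative[OF bounded_bilinear_inner y' y'])
  moreover have "((\<lambda>s. y s \<bullet> y s) has_vector_derivative 0) (at t)"
    by (rule has_vector_derivative_transform_within_open[OF has_vector_derivative_const assms(1,2), of 1])
      (use assms(3) in \<open>simp add: norm_eq_1\<close>)
  ultimately have "y t \<bullet> z + z \<bullet> y t = 0" using vector_derivative_unique_at by blast
  then show ?thesis by (simp add: inner_commute)
qed

text \<open>
  The algebra behind the derivative of the developed velocity \<open>w * k / d\<close>, where \<open>w' = - w * k / d\<close>,
  \<open>d' = - 2 * p\<close> and \<open>k' = z - 1\<close>: as \<open>d\<close> is the squared modulus of \<open>k\<close> and \<open>p\<close> its real part, all
  terms that do not involve \<open>z\<close> cancel.
\<close>

lemma developed_velocity_derivative: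
  fixes d p k w z :: "'a::field"
  assumes "d \<noteq> 0" and k: "2 * p * k - k * k = d"
  shows "w * k * (2 * p / d\<^sup>2) + (w * (z - 1) - w * k / d * k) * inverse d = w / d * z"
proof -
  have "w * k * (2 * p / d\<^sup>2) + (w * (z - 1) - w * k / d * k) * inverse d
      = w * (2 * p * k - k * k) / d\<^sup>2 + w * (z - 1) / d"
    using \<open>d \<noteq> 0\<close> by (simp add: field_simps power2_eq_square)
  also have "\<dots> = w / d * z"
    unfolding k using \<open>d \<noteq> 0\<close> by (simp add: field_simps power2_eq_square)
  finally show ?thesis .
qed

text \<open>
  Here \<open>y\<close> is the velocity of a curve and \<open>W\<close> the vector that leads from the current point to the apex, so
  that \<open>W' = - y\<close>. Let \<open>D\<close> be the squared distance to the apex, \<open>p\<close> the inner product of \<open>W\<close> and \<open>y\<close>, and \<open>q\<close> the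
  norm of the component of \<open>W\<close> orthogonal to \<open>y\<close>. In the plane, a curve with remaining vector \<open>w\<close>, the
  same distance to its apex, and a velocity \<open>\<eta>\<close> at the same angle to the ray to the apex satisfies
  \<open>\<eta> = w * (p + \<i> * q) / D\<close> and \<open>w' = - \<eta>\<close>. This linear equation is solved by the exponential of an
  antiderivative of \<open>- (p + \<i> * q) / D\<close>, whose modulus is the square root of \<open>D\<close> after normalization.

  The velocity \<open>\<eta>\<close> turns no faster than \<open>y\<close>. Indeed, write \<open>z = y'\<close> and let \<open>s\<close> be the inner product of \<open>z\<close>
  and \<open>W\<close>. Then \<open>p' = s - 1\<close> and \<open>\<eta>' = (w / D) * (s + \<i> * q')\<close>, and \<open>p\<^sup>2 + q\<^sup>2 = D\<close> gives
  \<open>q * q' = - p * s\<close>. As \<open>z\<close> is orthogonal to \<open>y\<close>, \<open>\<bar>s\<bar> \<le> norm z * q\<close>, hence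
  \<open>s\<^sup>2 + q'\<^sup>2 = s\<^sup>2 * D / q\<^sup>2 \<le> D\<close> and \<open>norm \<eta>' \<le> 1\<close>. Where \<open>q\<close> vanishes, \<open>s\<close> does too, and off the
  transversal zeros of the orthogonal component so does \<open>q'\<close>.
\<close>

lemma development_away_from_apex:
  fixes y W :: "real \<Rightarrow> 'a::euclidean_space"
  assumes lip: "1-lipschitz_on {a<..<b} y" and unit: "\<And>t. t \<in> {a<..<b} \<Longrightarrow> norm (y t) = 1"
    and N: "negligible N" "\<And>t. t \<in> {a<..<b} - N \<Longrightarrow> y differentiable (at t)"
    and W: "\<And>t. t \<in> {a<..<b} \<Longrightarrow> (W has_vector_derivative - y t) (at t)"
    and nz: "\<And>t. t \<in> {a<..<b} \<Longrightarrow> W t \<noteq> 0"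
  obtains w \<eta> :: "real \<Rightarrow> complex" and N'
  where "1-lipschitz_on {a<..<b} \<eta>" and "\<And>t. t \<in> {a<..<b} \<Longrightarrow> norm (\<eta> t) = 1"
    and "negligible N'" and "\<And>t. t \<in> {a<..<b} - N' \<Longrightarrow> \<eta> differentiable (at t)"
    and "\<And>t. t \<in> {a<..<b} \<Longrightarrow> (w has_vector_derivative - \<eta> t) (at t)"
    and "\<And>t. t \<in> {a<..<b} \<Longrightarrow> norm (w t) = norm (W t)"
    and "\<And>t. t \<in> {a<..<b} \<Longrightarrow> w t \<bullet> \<eta> t = W t \<bullet> y t"
proof -
  let ?I = "{a<..<b}"
  define D where "D t = W t \<bullet> W t" for t
  define p where "p t = W t \<bullet> y t" for t
  define g where "g t = W t - p t *\<^sub>R y t" for t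
  define q where "q t = norm (g t)" for t
  define k where "k t = (of_real (p t) + \<i> * of_real (q t) :: complex)" for t
  have contW: "continuous_on ?I W"
    using W by (meson continuous_at_imp_continuous_on has_vector_derivative_continuous)
  have conty: "continuous_on ?I y" using lip by (rule lipschitz_on_continuous_on)
  have Dpos: "D t > 0" if "t \<in> ?I" for t using nz[OF that] by (simp add: D_def)
  have Dnorm: "D t = norm (W t) ^ 2" for t by (simp add: D_def power2_norm_eq_inner)
  have yy: "y t \<bullet> y t = 1" if "t \<in> ?I" for t using unit[OF that] by (simp add: norm_eq_1)
  have q2: "q t ^ 2 = D t - p t ^ 2" if "t \<in> ?I" for t
    using yy[OF that] unfolding q_def g_def D_def power2_norm_eq_inner
    by (simp add: inner_diff_left inner_diff_right p_def inner_commute power2_eq_square)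
  have k2: "norm (k t) ^ 2 = D t" if "t \<in> ?I" for t
    using q2[OF that] by (simp add: k_def cmod_power2)
  have contp: "continuous_on ?I p" unfolding p_def using contW conty by (intro continuous_intros)
  have contg: "continuous_on ?I g" unfolding g_def using contW conty contp by (intro continuous_intros)
  have contD: "continuous_on ?I D" unfolding D_def using contW by (intro continuous_intros)
  have contk: "continuous_on ?I k" unfolding k_def q_def using contp contg by (intro continuous_intros)
  have contkD: "continuous_on ?I (\<lambda>t. - k t / of_real (D t))"
    using contk contD Dpos by (intro continuous_intros) (auto simp: less_imp_neq[THEN not_sym])
  have D': "(D has_real_derivative - 2 * p t) (at t)" if "t \<in> ?I" for t
    using bounded_bilinear.has_vector_derivative[OF bounded_bilinear_inner W[OF that] W[OF that]]
    by (simp add: D_def[abs_def] p_def has_real_derivative_iff_has_vector_derivative inner_commute)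
  have "\<exists>F. \<forall>t. ereal a < ereal t \<longrightarrow> ereal t < ereal b \<longrightarrow> (F has_vector_derivative - k t / of_real (D t)) (at t)"
    if "a < b"
    by (rule einterval_antiderivative)
      (use contkD that in \<open>auto simp: continuous_on_eq_continuous_at\<close>)
  then obtain L0 where L0: "\<And>t. t \<in> ?I \<Longrightarrow> (L0 has_vector_derivative - k t / of_real (D t)) (at t)"
    by (cases "a < b") auto
  have "\<exists>c. \<forall>t\<in>?I. Re (L0 t) - ln (D t) / 2 = c"
  proof (rule has_field_derivative_zero_constant)
    fix t assume t: "t \<in> ?I"
    have "((\<lambda>t. Re (L0 t)) has_vector_derivative Re (- k t / of_real (D t))) (at t)"
      by (rule bounded_linear.has_vector_derivative[OF bounded_linear_Re L0[OF t]])
    then have "((\<lambda>t. Re (L0 t)) has_real_derivative - p t / D t) (at t)"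
      by (simp add: has_real_derivative_iff_has_vector_derivative k_def)
    moreover have "((\<lambda>t. ln (D t)) has_real_derivative inverse (D t) * (- 2 * p t)) (at t)"
      by (rule DERIV_chain'[OF D'[OF t] DERIV_ln[OF Dpos[OF t]]])
    ultimately have "((\<lambda>t. Re (L0 t) - ln (D t) / 2) has_real_derivative
        - p t / D t - inverse (D t) * (- 2 * p t) / 2) (at t)"
      by (intro DERIV_diff DERIV_cdivide)
    moreover have "- p t / D t - inverse (D t) * (- 2 * p t) / 2 = 0"
      using Dpos[OF t] by (simp add: field_simps)
    ultimately have "((\<lambda>t. Re (L0 t) - ln (D t) / 2) has_real_derivative 0) (at t)"
      by simp
    then show "((\<lambda>t. Re (L0 t) - ln (D t) / 2) has_real_derivative 0) (at t within ?I)"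
      by (rule has_field_derivative_at_within)
  qed auto
  then obtain c where "\<forall>t\<in>?I. Re (L0 t) - ln (D t) / 2 = c" by blast
  then have c: "Re (L0 t) - c = ln (D t) / 2" if "t \<in> ?I" for t
    using that by (metis diff_diff_eq2 add_diff_cancel_left')
  \<comment> \<open>Subtracting \<open>c\<close> makes the modulus of \<open>w\<close> equal to the distance \<open>norm (W t)\<close>.\<close>
  define w where "w t = exp (L0 t - of_real c)" for t
  define \<eta> where "\<eta> t = w t * k t / of_real (D t)" for t
  have normw: "norm (w t) = norm (W t)" if "t \<in> ?I" for t
  proof -
    have "norm (w t) = exp (ln (D t) / 2)" using c[OF that] by (simp add: w_def)
    also have "\<dots> = norm (W t)"
      using nz[OF that] by (simp add: Dnorm ln_realpow)
    finally show ?thesis .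
  qed
  have w': "(w has_vector_derivative - \<eta> t) (at t)" if "t \<in> ?I" for t
  proof -
    have "((\<lambda>t. L0 t - of_real c) has_vector_derivative (- k t / of_real (D t) - 0)) (at t)"
      by (rule has_vector_derivative_diff[OF L0[OF that] has_vector_derivative_const])
    then have "((exp \<circ> (\<lambda>t. L0 t - of_real c)) has_vector_derivative (- k t / of_real (D t) - 0) * exp (L0 t - of_real c)) (at t)"
      by (rule field_vector_diff_chain_at) (rule DERIV_exp)
    then show ?thesis by (simp add: o_def w_def[abs_def] \<eta>_def mult.commute)
  qed
  have unit\<eta>: "norm (\<eta> t) = 1" if "t \<in> ?I" for t
  proof -
    have "norm (\<eta> t) ^ 2 = norm (w t) ^ 2 * norm (k t) ^ 2 / D t ^ 2"
      by (simp add: \<eta>_def norm_mult norm_divide power_mult_distrib power_divide)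
    also have "\<dots> = 1"
      using k2[OF that] normw[OF that] nz[OF that] Dnorm[of t] by (simp add: power2_eq_square)
    finally show ?thesis by (smt (verit) norm_ge_zero power2_eq_1_iff)
  qed
  have inner: "w t \<bullet> \<eta> t = W t \<bullet> y t" if "t \<in> ?I" for t
  proof -
    have "w t \<bullet> \<eta> t = Re (cnj (w t) * \<eta> t)" by (simp add: inner_complex_def)
    also have "cnj (w t) * \<eta> t = of_real (norm (w t) ^ 2) * k t / of_real (D t)"
      unfolding complex_norm_square by (simp add: \<eta>_def mult_ac)
    also have "\<dots> = k t" using normw[OF that] Dpos[OF that] by (simp add: Dnorm)
    finally show ?thesis by (simp add: k_def p_def)
  qed
  \<comment> \<open>A crude Lipschitz constant, only locally uniform; the bound on the derivative improves it to one.\<close>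
  have lip\<eta>: "\<exists>C. C-lipschitz_on {u..v} \<eta>" if uv: "{u..v} \<subseteq> ?I" for u v
  proof -
    have nz0: "D t \<noteq> 0" if "t \<in> {u..v}" for t using Dpos[of t] that uv by auto
    note bil = bilinear_lipschitz_on_compact[OF _ compact_Icc]
    have ly: "\<exists>C. C-lipschitz_on {u..v} y" using lipschitz_on_subset[OF lip uv] by blast
    have lW: "\<exists>C. C-lipschitz_on {u..v} W"
      by (rule C1_lipschitz_on_compact[of u v W "\<lambda>t. - y t"])
        (use W uv conty in \<open>auto intro: continuous_on_subset continuous_intros\<close>)
    have lp: "\<exists>C. C-lipschitz_on {u..v} p"
      unfolding p_def by (rule bil[OF bounded_bilinear_inner lW ly])
    have "\<exists>C. C-lipschitz_on {u..v} g"
      unfolding g_def using lW bil[OF bounded_bilinear_scaleR lp ly] lipschitz_on_diff by blast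
    then have lq: "\<exists>C. C-lipschitz_on {u..v} q"
      unfolding q_def using lipschitz_norm by blast
    have cx: "\<exists>C. C-lipschitz_on {u..v} (\<lambda>t. complex_of_real (f t))" if "\<exists>C. C-lipschitz_on {u..v} f" for f
      using that unfolding lipschitz_on_def dist_norm by (simp flip: of_real_diff)
    have "\<exists>C. C-lipschitz_on {u..v} (\<lambda>t. \<i> * complex_of_real (q t))"
      by (rule bil[OF bounded_bilinear_mult _ cx[OF lq]]) (auto intro: lipschitz_on_constant)
    then have lk: "\<exists>C. C-lipschitz_on {u..v} k"
      unfolding k_def using cx[OF lp] lipschitz_on_add by blast
    have "\<exists>C. C-lipschitz_on {u..v} w"
    proof (rule C1_lipschitz_on_compact)
      have "continuous_on ?I w"
        using w' by (meson continuous_at_imp_continuous_on has_vector_derivative_continuous)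
      then show "continuous_on {u..v} (\<lambda>t. - \<eta> t)"
        unfolding \<eta>_def using contk contD Dpos uv
        by (intro continuous_intros) (use nz0 in \<open>auto elim: continuous_on_subset\<close>)
    qed (use w' uv in auto)
    then have lwk: "\<exists>C. C-lipschitz_on {u..v} (\<lambda>t. w t * k t)"
      using bil[OF bounded_bilinear_mult _ lk] by blast
    have "\<exists>C. C-lipschitz_on {u..v} (\<lambda>t. inverse (D t))"
    proof (rule C1_lipschitz_on_compact)
      show "((\<lambda>t. inverse (D t)) has_vector_derivative - ((- 2 * p t) * inverse (D t ^ 2))) (at t)" if "t \<in> {u..v}" for t
        using that uv DERIV_inverse_fun[OF D'[of t]] Dpos[of t]
        by (auto simp: has_real_derivative_iff_has_vector_derivative[symmetric] power2_eq_square subset_iff numeral_2_eq_2)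
      show "continuous_on {u..v} (\<lambda>t. - ((- 2 * p t) * inverse (D t ^ 2)))"
        using contp contD Dpos uv
        by (intro continuous_intros) (use nz0 in \<open>auto elim: continuous_on_subset\<close>)
    qed
    from bil[OF bounded_bilinear_mult lwk cx[OF this]] show ?thesis
      by (simp add: \<eta>_def[abs_def] field_simps)
  qed
  define Z where "Z = {t. g t = 0 \<and> (\<exists>g'. (g has_vector_derivative g') (at t) \<and> g' \<noteq> 0)}"
  have "negligible Z" unfolding Z_def negligible_iff_null_sets
    by (rule null_sets_completionI[OF countable_imp_null_set_lborel[OF countable_transversal_zeros]])
  have deriv: "\<exists>e. (\<eta> has_vector_derivative e) (at t) \<and> norm e \<le> 1" if t: "t \<in> ?I" "t \<notin> N \<union> Z" for t
  proof -
    obtain z where z: "(y has_vector_derivative z) (at t)"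
      using N(2) t vector_derivative_works by (metis Diff_iff UnCI)
    have zle: "norm z \<le> 1"
      by (rule vector_derivative_norm_le_lipschitz[OF lip _ t(1) z]) simp
    have yz: "y t \<bullet> z = 0"
      by (rule unit_speed_derivative_orthogonal[OF _ t(1) unit z]) simp
    define s where "s = z \<bullet> W t"
    have notZ: "g' = 0" if "g t = 0" "(g has_vector_derivative g') (at t)" for g'
      using t(2) that by (auto simp: Z_def)
    have "(p has_vector_derivative (W t \<bullet> z + (- y t) \<bullet> y t)) (at t)"
      unfolding p_def[abs_def]
      by (rule bounded_bilinear.has_vector_derivative[OF bounded_bilinear_inner W[OF t(1)] z])
    then have p': "(p has_real_derivative (s - 1)) (at t)"
      using yy[OF t(1)] by (simp add: s_def inner_commute has_real_derivative_iff_has_vector_derivative)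
    have s2: "s ^ 2 \<le> q t ^ 2"
    proof -
      have "s = z \<bullet> g t" using yz by (simp add: s_def g_def inner_diff_right inner_commute)
      then have "\<bar>s\<bar> \<le> norm z * q t" unfolding q_def by (metis Cauchy_Schwarz_ineq2)
      also have "\<dots> \<le> q t" using zle by (simp add: q_def mult_left_le_one_le)
      finally show ?thesis by (meson abs_le_square_iff abs_ge_self order_trans)
    qed
    have "\<exists>q'. (q has_real_derivative q') (at t) \<and> s ^ 2 + q' ^ 2 \<le> D t"
    proof (cases "g t = 0")
      case True
      have "(g has_vector_derivative (- y t - (p t *\<^sub>R z + (s - 1) *\<^sub>R y t))) (at t)"
        unfolding g_def[abs_def]
        by (rule has_vector_derivative_diff[OF W[OF t(1)] has_vector_derivative_scaleR[OF p' z]])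
      then have "(g has_vector_derivative 0) (at t)"
        using notZ[OF True] by metis
      then have "((\<lambda>s. (g s - g t) /\<^sub>R norm (s - t)) \<longlongrightarrow> 0) (at t)"
        unfolding has_vector_derivative_def has_derivative_at_within by simp
      then have "((\<lambda>s. norm (g s - g t) / norm (s - t)) \<longlongrightarrow> 0) (at t)"
        using tendsto_norm_zero by (fastforce simp: divide_inverse mult.commute)
      then have "((\<lambda>s. norm ((q s - q t) / norm (s - t))) \<longlongrightarrow> 0) (at t)"
        using True by (simp add: q_def)
      then have "((\<lambda>s. (q s - q t) /\<^sub>R norm (s - t)) \<longlongrightarrow> 0) (at t)"
        by (subst (asm) tendsto_norm_zero_iff) (simp add: divide_inverse mult.commute)
      then have "(q has_vector_derivative 0) (at t)"
        unfolding has_vector_derivative_def has_derivative_at_within by (simp add: bounded_linear_zero)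
      moreover have "s ^ 2 \<le> 0" using s2 True by (simp add: q_def)
      ultimately show ?thesis 
        using Dpos[OF t(1)] by (auto simp: has_real_derivative_iff_has_vector_derivative intro!: exI[of _ 0])
    next
      case False
      then have q0: "q t > 0" by (simp add: q_def)
      have sq: "sqrt (D t - p t ^ 2) = q t" if "t \<in> ?I" for t
        using q2[OF that] by (metis norm_ge_zero q_def real_sqrt_unique)
      have "((\<lambda>t. D t - p t ^ 2) has_real_derivative (- 2 * p t - 2 * p t * (s - 1))) (at t)"
        using D'[OF t(1)] p' by (auto intro!: derivative_eq_intros)
      from DERIV_chain'[OF this DERIV_real_sqrt]
      have "((\<lambda>t. sqrt (D t - p t ^ 2)) has_real_derivative (- (p t * s) / q t)) (at t)"
        by (rule DERIV_cong) (use q0 in \<open>simp_all add: sq[OF t(1)] q2[OF t(1), symmetric] field_simps\<close>)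
      then have "(q has_real_derivative (- (p t * s) / q t)) (at t)"
      proof (rule has_field_derivative_transform_within_open[of _ _ _ ?I])
        show "sqrt (D t - p t ^ 2) = q t" if "t \<in> ?I" for t
          by (rule sq[OF that])
      qed (use t in auto)
      moreover have "s ^ 2 + (- (p t * s) / q t) ^ 2 = s ^ 2 * (q t ^ 2 + p t ^ 2) / q t ^ 2"
        using q0 by (simp add: power_divide power_mult_distrib field_simps)
      moreover have "\<dots> = s ^ 2 / q t ^ 2 * D t" using q2[OF t(1)] by simp
      moreover have "s ^ 2 / q t ^ 2 * D t \<le> D t"
      proof -
        have "s ^ 2 / q t ^ 2 \<le> 1" using s2 q0 by simp
        then show ?thesis using mult_right_mono[of "s ^ 2 / q t ^ 2" 1 "D t"] Dpos[OF t(1)] by simp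
      qed
      ultimately show ?thesis by metis
    qed
    then obtain q' where q': "(q has_real_derivative q') (at t)" and bound: "s ^ 2 + q' ^ 2 \<le> D t" by blast
    have k': "(k has_vector_derivative (of_real (s - 1) + \<i> * of_real q')) (at t)"
      unfolding k_def[abs_def]
      by (intro has_vector_derivative_add has_vector_derivative_of_real p' has_vector_derivative_mult_right q')
    have "((\<lambda>t. inverse (D t)) has_real_derivative (2 * p t / D t ^ 2)) (at t)"
      using D'[OF t(1)] Dpos[OF t(1)] by (auto intro!: derivative_eq_intros simp: power2_eq_square field_simps)
    from has_vector_derivative_mult[OF has_vector_derivative_mult[OF w'[OF t(1)] k'] has_vector_derivative_of_real[OF this]]
    have "(\<eta> has_vector_derivative (w t * k t * of_real (2 * p t / D t ^ 2) 
        + (w t * (of_real (s - 1) + \<i> * of_real q') + - \<eta> t * k t) * of_real (inverse (D t)))) (at t)"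
      (is "(_ has_vector_derivative ?e) _") by (simp add: \<eta>_def[abs_def] divide_inverse)
    moreover have "?e = w t / of_real (D t) * (of_real s + \<i> * of_real q')"
    proof -
      have "2 * of_real (p t) * k t - k t * k t = (of_real (p t) - \<i> * of_real (q t)) * k t"
        by (simp add: k_def algebra_simps)
      also have "\<dots> = complex_of_real (D t)"
        using q2[OF t(1)] by (simp add: k_def complex_eq_iff power2_eq_square)
      finally show ?thesis
        using developed_velocity_derivative[of "of_real (D t)" "of_real (p t)" "k t" "w t" "of_real s + \<i> * of_real q'"]
          Dpos[OF t(1)] by (simp add: \<eta>_def algebra_simps)
    qed
    moreover have "norm (w t / of_real (D t) * (of_real s + \<i> * of_real q')) \<le> 1"
    proof -
      have "norm (w t / of_real (D t) * (of_real s + \<i> * of_real q')) ^ 2 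
          = norm (w t) ^ 2 / D t ^ 2 * (s ^ 2 + q' ^ 2)"
        by (simp add: norm_mult norm_divide power_mult_distrib power_divide cmod_power2)
      also have "\<dots> = (s ^ 2 + q' ^ 2) / D t"
        using normw[OF t(1)] nz[OF t(1)] by (simp add: Dnorm power2_eq_square)
      also have "\<dots> \<le> 1" using bound Dpos[OF t(1)] by simp
      finally show ?thesis by (simp add: power_le_one_iff)
    qed
    ultimately show ?thesis by metis
  qed
  have "1-lipschitz_on ?I \<eta>"
  proof (rule lipschitz_on_leI)
    fix u v assume uv: "u \<in> ?I" "v \<in> ?I" "u \<le> v"
    then have sub: "{u..v} \<subseteq> ?I" by auto
    obtain C where "C-lipschitz_on {u..v} \<eta>" using lip\<eta>[OF sub] by blast
    then have ac: "absolutely_continuous_on {u..v} \<eta>" by (rule lipschitz_imp_absolutely_continuous)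
    have "1-lipschitz_on {u..v} \<eta>"
    proof (rule absolutely_continuous_imp_lipschitz[OF ac])
      show "negligible (N \<union> Z)" using N(1) \<open>negligible Z\<close> by (rule negligible_Un)
      show "\<exists>e. (\<eta> has_vector_derivative e) (at t) \<and> norm e \<le> 1" if "t \<in> {u<..<v} - (N \<union> Z)" for t
        by (rule deriv) (use that uv in auto)
    qed simp
    then show "dist (\<eta> u) (\<eta> v) \<le> 1 * dist u v" using uv by (auto dest: lipschitz_onD)
  qed simp
  then show thesis
  proof (rule that)
    show "negligible (N \<union> Z)" using N(1) \<open>negligible Z\<close> by (rule negligible_Un)
    show "\<eta> differentiable (at t)" if "t \<in> ?I - (N \<union> Z)" for t
      using deriv[of t] that by (metis Diff_iff differentiableI_vector)
  qed (use unit\<eta> w' normw inner in auto)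
qed

section \<open>Developing a whole curve\<close>

text \<open>
  The derivative is only asked to exist almost everywhere; its norm is at most one because of the
  Lipschitz bound. In this form the notion survives restriction and concatenation.
\<close>

definition unit_velocity :: "real \<Rightarrow> real \<Rightarrow> (real \<Rightarrow> 'a::euclidean_space) \<Rightarrow> bool" where
  "unit_velocity a b y \<longleftrightarrow> 1-lipschitz_on {a..b} y \<and> (\<forall>t\<in>{a..b}. norm (y t) = 1) \<and>
     (\<exists>N. negligible N \<and> (\<forall>t\<in>{a<..<b} - N. y differentiable (at t)))"

lemma unit_velocityD:
  assumes "unit_velocity a b y"
  shows "1-lipschitz_on {a..b} y" and "\<And>t. t \<in> {a..b} \<Longrightarrow> norm (y t) = 1"
    and "continuous_on {a..b} y" and "y integrable_on {a..b}"
  using assms lipschitz_on_continuous_on integrable_continuous_real unfolding unit_velocity_def by blast+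

lemma unit_velocity_subinterval:
  assumes y: "unit_velocity a b y" and "a \<le> c" "d \<le> b"
  shows "unit_velocity c d y"
proof -
  have sub: "{c..d} \<subseteq> {a..b}" "{c<..<d} \<subseteq> {a<..<b}" using assms(2,3) by auto
  then show ?thesis
    using y lipschitz_on_subset unfolding unit_velocity_def by (meson Diff_iff subsetD)
qed

lemma integral_has_vector_derivative_interior:
  fixes f :: "real \<Rightarrow> 'a::banach"
  assumes "continuous_on {a..b} f" and t: "t \<in> {a<..<b}"
  shows "((\<lambda>u. integral {a..u} f) has_vector_derivative f t) (at t)"
  using integral_has_vector_derivative[OF assms(1), of t] t by (simp add: at_within_Icc_at)

text \<open>
  On the open interval the curve avoids its endpoint, so it can be developed there. The developed
  velocity is Lipschitz and extends to the closed interval, and the remaining vectors and their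
  inner products with the velocities keep agreeing at both ends by continuity. At the right end the
  remaining vector vanishes, which identifies the constant of integration with the total
  displacement.
\<close>

lemma development_simple:
  fixes y :: "real \<Rightarrow> 'a::euclidean_space"
  assumes "a < b" and y: "unit_velocity a b y"
    and nz: "\<And>t. t \<in> {a<..<b} \<Longrightarrow> integral {a..t} y \<noteq> integral {a..b} y"
  obtains h :: "real \<Rightarrow> complex" where "unit_velocity a b h"
    and "norm (integral {a..b} h) = norm (integral {a..b} y)"
    and "h a \<bullet> integral {a..b} h = y a \<bullet> integral {a..b} y"
proof -
  note yD = unit_velocityD[OF y]
  obtain N where N: "negligible N" "\<And>t. t \<in> {a<..<b} - N \<Longrightarrow> y differentiable (at t)"
    using y unfolding unit_velocity_def by blast
  define W where "W t = integral {a..b} y - integral {a..t} y" for t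
  have W': "(W has_vector_derivative - y t) (at t)" if "t \<in> {a<..<b}" for t
    using has_vector_derivative_diff[OF has_vector_derivative_const integral_has_vector_derivative_interior[OF yD(3) that], of "integral {a..b} y"]
    by (simp add: W_def[abs_def])
  have W0: "W t \<noteq> 0" if "t \<in> {a<..<b}" for t using nz[OF that] by (simp add: W_def)
  have y1: "norm (y t) = 1" if "t \<in> {a<..<b}" for t using yD(2) that by simp
  have lip: "1-lipschitz_on {a<..<b} y" by (rule lipschitz_on_subset[OF yD(1)]) auto
  obtain w \<eta> :: "real \<Rightarrow> complex" and N' where \<eta>: "1-lipschitz_on {a<..<b} \<eta>" 
      "\<And>t. t \<in> {a<..<b} \<Longrightarrow> norm (\<eta> t) = 1"
    and N': "negligible N'" "\<And>t. t \<in> {a<..<b} - N' \<Longrightarrow> \<eta> differentiable (at t)"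
    and w': "\<And>t. t \<in> {a<..<b} \<Longrightarrow> (w has_vector_derivative - \<eta> t) (at t)"
    and normw: "\<And>t. t \<in> {a<..<b} \<Longrightarrow> norm (w t) = norm (W t)"
    and inner: "\<And>t. t \<in> {a<..<b} \<Longrightarrow> w t \<bullet> \<eta> t = W t \<bullet> y t"
    using development_away_from_apex[OF lip y1 N W' W0] by metis
  have cl: "closure {a<..<b} = {a..b}" using \<open>a < b\<close> by simp
  obtain h where h: "1-lipschitz_on {a..b} h" "\<And>t. t \<in> {a<..<b} \<Longrightarrow> h t = \<eta> t"
    using lipschitz_extend_closure[OF \<eta>(1)] unfolding cl by blast
  have conth: "continuous_on {a..b} h" using h(1) by (rule lipschitz_on_continuous_on)
  define H where "H t = integral {a..t} h" for t
  have contH: "continuous_on {a..b} H"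
    unfolding H_def by (intro indefinite_integral_continuous_1 integrable_continuous_real conth)
  have contW: "continuous_on {a..b} W"
    unfolding W_def by (intro continuous_intros indefinite_integral_continuous_1 yD(4))
  have extend: "f t = c" if "continuous_on {a..b} f" "\<And>t. t \<in> {a<..<b} \<Longrightarrow> f t = c" "t \<in> {a..b}"
    for f :: "real \<Rightarrow> real" and c t
    using continuous_constant_on_closure[of "{a<..<b}" f c t] that unfolding cl by blast
  have "\<exists>k. \<forall>t\<in>{a<..<b}. w t + H t = k"
  proof (rule has_derivative_zero_constant)
    fix t assume t: "t \<in> {a<..<b}"
    have "((\<lambda>t. w t + H t) has_vector_derivative (- \<eta> t + h t)) (at t)"
      unfolding H_def by (rule has_vector_derivative_add[OF w'[OF t] integral_has_vector_derivative_interior[OF conth t]])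
    then show "((\<lambda>t. w t + H t) has_derivative (\<lambda>h. 0)) (at t within {a<..<b})"
      using h(2)[OF t] by (simp add: has_vector_derivative_def has_derivative_at_withinI)
  qed simp
  then obtain k where "\<forall>t\<in>{a<..<b}. w t + H t = k" by blast
  then have k: "w t = k - H t" if "t \<in> {a<..<b}" for t using that by (metis add_diff_cancel_right')
  have norm0: "norm (k - H t) - norm (W t) = 0" if "t \<in> {a..b}" for t
    by (rule extend[OF _ _ that]) (use normw k in \<open>auto intro!: continuous_intros contH contW\<close>)
  have inner0: "(k - H t) \<bullet> h t - W t \<bullet> y t = 0" if "t \<in> {a..b}" for t
    by (rule extend[OF _ _ that]) (use inner k h in \<open>auto intro!: continuous_intros contH contW conth yD(3)\<close>)
  have unit: "norm (h t) = 1" if "t \<in> {a..b}" for t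
    by (rule extend[OF _ _ that]) (use \<eta>(2) h in \<open>auto intro!: continuous_intros conth\<close>)
  have "H b = k" using norm0[of b] \<open>a < b\<close> by (simp add: W_def)
  moreover have "H a = 0" "W a = integral {a..b} y" by (simp_all add: H_def W_def)
  ultimately have "norm (integral {a..b} h) = norm (integral {a..b} y)"
      "h a \<bullet> integral {a..b} h = y a \<bullet> integral {a..b} y"
    using norm0[of a] inner0[of a] \<open>a < b\<close> by (simp_all add: H_def inner_commute)
  moreover have "unit_velocity a b h"
  proof -
    have "h differentiable (at t)" if t: "t \<in> {a<..<b} - N'" for t
    proof -
      obtain z where "(\<eta> has_vector_derivative z) (at t)"
        using N'(2)[OF t] vector_derivative_works by metis
      then have "(h has_vector_derivative z) (at t)"
        by (rule has_vector_derivative_transform_within_open[of _ _ _ "{a<..<b}"]) (use t h in auto)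
      then show ?thesis by (rule differentiableI_vector)
    qed
    then show ?thesis using h(1) unit N'(1) unfolding unit_velocity_def by blast
  qed
  ultimately show thesis using that by blast
qed

lemma unit_velocity_rotate:
  fixes h :: "real \<Rightarrow> complex"
  assumes h: "unit_velocity a b h" and c: "norm c = 1"
  shows "unit_velocity a b (\<lambda>t. c * h t)"
proof -
  have "1-lipschitz_on {a..b} (\<lambda>t. c * h t)"
    using unit_velocityD(1)[OF h] c unfolding lipschitz_on_def dist_norm
    by (simp add: norm_mult flip: right_diff_distrib)
  then show ?thesis
    using h c unfolding unit_velocity_def by (auto simp: norm_mult)
qed

text \<open>
  Multiplication by a unit complex number turns a planar curve to a prescribed initial velocity;
  this is needed for attaching one developed piece to another.
\<close>

lemma development_simple_from:
  fixes y :: "real \<Rightarrow> 'a::euclidean_space"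
  assumes "a < b" and y: "unit_velocity a b y"
    and nz: "\<And>t. t \<in> {a<..<b} \<Longrightarrow> integral {a..t} y \<noteq> integral {a..b} y"
    and v: "norm v = 1"
  obtains h :: "real \<Rightarrow> complex" where "unit_velocity a b h" and "h a = v"
    and "norm (integral {a..b} h) = norm (integral {a..b} y)"
    and "v \<bullet> integral {a..b} h = y a \<bullet> integral {a..b} y"
proof -
  obtain h :: "real \<Rightarrow> complex" where h: "unit_velocity a b h"
    "norm (integral {a..b} h) = norm (integral {a..b} y)"
    "h a \<bullet> integral {a..b} h = y a \<bullet> integral {a..b} y"
    using development_simple[OF assms(1-3)] by blast
  have ha: "norm (h a) = 1" using unit_velocityD(2)[OF h(1), of a] \<open>a < b\<close> by simp
  define c where "c = v / h a"
  have c: "norm c = 1" "c * h a = v" using v ha by (auto simp: c_def norm_divide)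
  have int: "integral {a..b} (\<lambda>t. c * h t) = c * integral {a..b} h"
    by simp
  have "(c * p) \<bullet> (c * q) = norm c ^ 2 * (p \<bullet> q)" for p q :: complex
    unfolding cmod_power2 by (simp add: inner_complex_def algebra_simps power2_eq_square)
  then have "v \<bullet> (c * integral {a..b} h) = h a \<bullet> integral {a..b} h"
    using c by (metis mult_1 power_one)
  then show thesis
    using that[of "\<lambda>t. c * h t"] unit_velocity_rotate[OF h(1) c(1)] c h int by (simp add: norm_mult)
qed

text \<open>
  On an interval shorter than one the velocity stays so close to its initial value that the
  displacement cannot vanish. This bounds the number of times that a curve passes through its endpoint.
\<close>

lemma closed_unit_velocity_length:
  fixes y :: "real \<Rightarrow> 'a::euclidean_space"
  assumes y: "unit_velocity a b y" and "a < b" and closed: "integral {a..b} y = 0"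
  shows "1 \<le> b - a"
proof -
  note yD = unit_velocityD[OF y]
  have "norm (y t - y a) \<le> b - a" if "t \<in> {a..b}" for t
    using lipschitz_on_normD[OF yD(1), of t a] that \<open>a < b\<close> by auto
  then have "norm (integral {a..b} (\<lambda>t. y t - y a)) \<le> (b - a) * (b - a)"
    using \<open>a < b\<close> yD(3) by (intro integral_bound) (auto intro!: continuous_intros)
  moreover have "integral {a..b} (\<lambda>t. y t - y a) = - ((b - a) *\<^sub>R y a)"
    using closed \<open>a < b\<close> by (subst integral_diff) (auto intro: yD(4))
  ultimately have "b - a \<le> (b - a) * (b - a)"
    using yD(2)[of a] \<open>a < b\<close> by simp
  then show ?thesis using \<open>a < b\<close> by (simp add: mult_le_cancel_left1)
qed

lemma unit_velocity_concat:
  fixes f g :: "real \<Rightarrow> 'a::euclidean_space"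
  assumes f: "unit_velocity a c f" and g: "unit_velocity c b g" and fg: "f c = g c" and "a \<le> c" "c \<le> b"
  defines "h \<equiv> \<lambda>t. if t \<le> c then f t else g t"
  shows "unit_velocity a b h" and "integral {a..b} h = integral {a..c} f + integral {c..b} g"
proof -
  obtain M N where MN: "negligible M" "negligible N" "\<And>t. t \<in> {a<..<c} - M \<Longrightarrow> f differentiable (at t)"
    "\<And>t. t \<in> {c<..<b} - N \<Longrightarrow> g differentiable (at t)"
    using f g unfolding unit_velocity_def by blast
  have diff: "h differentiable (at t)" if t: "t \<in> {a<..<b} - (M \<union> N \<union> {c})" for t
  proof (cases "t < c")
    case True
    then obtain z where "(f has_vector_derivative z) (at t)"
      using MN(3)[of t] t vector_derivative_works by auto
    then have "(h has_vector_derivative z) (at t)"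
      by (rule has_vector_derivative_transform_within_open[of _ _ _ "{..<c}"]) (use True in \<open>auto simp: h_def\<close>)
    then show ?thesis by (rule differentiableI_vector)
  next
    case False
    with t have "c < t" by auto
    then obtain z where "(g has_vector_derivative z) (at t)"
      using MN(4)[of t] t vector_derivative_works by auto
    then have "(h has_vector_derivative z) (at t)"
      by (rule has_vector_derivative_transform_within_open[of _ _ _ "{c<..}"]) (use \<open>c < t\<close> in \<open>auto simp: h_def\<close>)
    then show ?thesis by (rule differentiableI_vector)
  qed
  have lip: "1-lipschitz_on {a..b} h"
    unfolding h_def by (rule lipschitz_on_concat[OF unit_velocityD(1)[OF f] unit_velocityD(1)[OF g] fg])
  have "norm (h t) = 1" if "t \<in> {a..b}" for t
    using that unit_velocityD(2)[OF f, of t] unit_velocityD(2)[OF g, of t] by (auto simp: h_def)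
  moreover have "negligible (M \<union> N \<union> {c})" using MN by (intro negligible_Un) auto
  ultimately show uh: "unit_velocity a b h" using lip diff unfolding unit_velocity_def by blast
  have "integral {a..b} h = integral {a..c} h + integral {c..b} h"
    using Henstock_Kurzweil_Integration.integral_combine[OF \<open>a \<le> c\<close> \<open>c \<le> b\<close> unit_velocityD(4)[OF uh]] by simp
  also have "integral {a..c} h = integral {a..c} f"
    by (rule Henstock_Kurzweil_Integration.integral_cong) (simp add: h_def)
  also have "integral {c..b} h = integral {c..b} g"
    by (rule Henstock_Kurzweil_Integration.integral_cong) (use fg in \<open>auto simp: h_def\<close>)
  finally show "integral {a..b} h = integral {a..c} f + integral {c..b} g" .
qed

text \<open>
  If the curve meets its endpoint before the end of the interval, it is cut at the last such time \<open>c\<close>.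
  The loop after \<open>c\<close> has displacement zero, so it contributes nothing to the total displacement whatever
  its initial direction, and its development can be attached to that of the part before \<open>c\<close>. The loop
  takes at least one unit of time, so induction on the duration applies to the part before \<open>c\<close>.
\<close>

theorem planar_development:
  fixes y :: "real \<Rightarrow> 'a::euclidean_space"
  assumes "a < b" and "unit_velocity a b y"
  obtains h :: "real \<Rightarrow> complex" where "unit_velocity a b h" and "h a = 1"
    and "norm (integral {a..b} h) = norm (integral {a..b} y)"
    and "Re (integral {a..b} h) = y a \<bullet> integral {a..b} y"
proof -
  have "\<exists>h :: real \<Rightarrow> complex. unit_velocity a b h \<and> h a = 1 \<and>
      norm (integral {a..b} h) = norm (integral {a..b} y) \<and> Re (integral {a..b} h) = y a \<bullet> integral {a..b} y"
    if "b - a \<le> real n" "a < b" "unit_velocity a b y" for n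
    using that
  proof (induction n arbitrary: b)
    case 0
    then show ?case by simp
  next
    case (Suc n)
    note y = \<open>unit_velocity a b y\<close> and yD = unit_velocityD[OF \<open>unit_velocity a b y\<close>]
    define Y where "Y t = integral {a..t} y" for t
    have tail: "Y b = Y t + integral {t..b} y" if "t \<in> {a..b}" for t
      using Henstock_Kurzweil_Integration.integral_combine[of a t b y] that yD(4) by (simp add: Y_def)
    show ?case
    proof (cases "\<exists>s\<in>{a<..<b}. Y s = Y b")
      case False
      then show ?thesis
        using development_simple_from[OF Suc.prems(2) y, of 1] by (auto simp: Y_def)
    next
      case True
      then obtain s where s: "s \<in> {a<..<b}" "Y s = Y b" by blast
      have early: "t \<le> b - 1" if "t \<in> {a..<b}" "Y t = Y b" for t
        using closed_unit_velocity_length[OF unit_velocity_subinterval[OF y, of t b]] tail[of t] that by auto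
      define Z where "Z = {t \<in> {a..b - 1}. Y t = Y b}"
      have "continuous_on {a..b} Y"
        unfolding Y_def by (rule indefinite_integral_continuous_1[OF yD(4)])
      then have "continuous_on {a..b - 1} Y" by (rule continuous_on_subset) auto
      then have "closed Z" unfolding Z_def by (rule continuous_closed_preimage_constant) simp
      then have "compact ({a..b - 1} \<inter> Z)" by (intro compact_Int_closed) auto
      moreover have "{a..b - 1} \<inter> Z = Z" by (auto simp: Z_def)
      ultimately have "compact Z" by simp
      moreover have "s \<in> Z" using s early[of s] by (simp add: Z_def)
      ultimately obtain c where c: "c \<in> Z" "\<And>t. t \<in> Z \<Longrightarrow> t \<le> c"
        using compact_attains_sup[of Z] by blast
      have ac: "a < c" "c \<le> b - 1" "Y c = Y b" using c(1) c(2)[OF \<open>s \<in> Z\<close>] s(1) by (auto simp: Z_def)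
      have loop: "integral {c..b} y = 0" using tail[of c] ac by simp
      obtain f :: "real \<Rightarrow> complex" where f: "unit_velocity a c f" "f a = 1"
        "norm (integral {a..c} f) = norm (integral {a..c} y)" "Re (integral {a..c} f) = y a \<bullet> integral {a..c} y"
        using Suc.IH[of c] Suc.prems ac unit_velocity_subinterval[OF y, of a c] by auto
      have "integral {c..t} y \<noteq> integral {c..b} y" if t: "t \<in> {c<..<b}" for t
      proof
        assume "integral {c..t} y = integral {c..b} y"
        then have "Y t = Y b"
          using Henstock_Kurzweil_Integration.integral_combine[of a c t y] loop ac t
            unit_velocityD(4)[OF unit_velocity_subinterval[OF y, of a t]] by (simp add: Y_def)
        then have "t \<in> Z" using early[of t] t ac by (simp add: Z_def)
        then show False using c(2) t by fastforce
      qed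
      moreover have "norm (f c) = 1" using unit_velocityD(2)[OF f(1)] ac by simp
      moreover have "unit_velocity c b y" using unit_velocity_subinterval[OF y, of c b] ac by simp
      moreover have "c < b" using ac by simp
      ultimately obtain g where g: "unit_velocity c b g" "g c = f c" "norm (integral {c..b} g) = norm (integral {c..b} y)"
        using development_simple_from[of c b y "f c"] by metis
      define h where "h = (\<lambda>t. if t \<le> c then f t else g t)"
      have "unit_velocity a b h" "integral {a..b} h = integral {a..c} f"
        using unit_velocity_concat[OF f(1) g(1)] g loop ac by (auto simp: h_def)
      moreover have "h a = 1" using f(2) ac by (simp add: h_def)
      ultimately show ?thesis using f ac(3) unfolding Y_def by auto
    qed
  qed
  then show thesis
    using assms that real_arch_simple[of "b - a"] by blast
qed

section \<open>Rotations about an axis and planes through it\<close>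

definition reflection :: "'a::real_inner \<Rightarrow> 'a \<Rightarrow> 'a" where
  "reflection n x = x - (2 * (n \<bullet> x) / (n \<bullet> n)) *\<^sub>R n"

lemma orthogonal_transformation_reflection: "orthogonal_transformation (reflection n)"
proof -
  have "linear (reflection n)"
    by (rule linearI) (simp_all add: reflection_def inner_add_right add_divide_distrib algebra_simps)
  moreover have "reflection n x \<bullet> reflection n y = x \<bullet> y" for x y
    by (cases "n = 0") (simp_all add: reflection_def inner_diff_left inner_diff_right inner_commute field_simps)
  ultimately show ?thesis by (simp add: orthogonal_transformation_def)
qed

text \<open>
  The reflection fixes \<open>a\<close> and \<open>cross3 n a\<close>, whose cross product is \<open>n\<close>, but negates \<open>n\<close>; an orthogonal
  map commutes with the cross product up to its determinant.
\<close>

lemma det_reflection: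
  fixes n a :: "real^3"
  assumes "n \<noteq> 0" "norm a = 1" "n \<bullet> a = 0"
  shows "det (matrix (reflection n)) = -1"
proof -
  have fix_orth: "reflection n x = x" if "n \<bullet> x = 0" for x
    using that by (simp add: reflection_def)
  have "cross3 a (cross3 n a) = n"
    using assms(2,3) by (simp add: Lagrange norm_eq_1 inner_commute)
  then have "n = cross3 (reflection n a) (reflection n (cross3 n a))"
    using fix_orth[OF assms(3)] fix_orth[of "cross3 n a"] by (simp add: dot_cross_self)
  also have "\<dots> = det (matrix (reflection n)) *\<^sub>R reflection n n"
    using cross_orthogonal_transformation[OF orthogonal_transformation_reflection, of n a "cross3 n a"]
      \<open>cross3 a (cross3 n a) = n\<close> by simp
  also have "reflection n n = - n" using assms(1) by (simp add: reflection_def scaleR_2)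
  finally have "det (matrix (reflection n)) *\<^sub>R n = (- 1) *\<^sub>R n"
    by (metis minus_minus scaleR_minus1_left scaleR_minus_right)
  then show ?thesis using assms(1) by (simp only: scaleR_cancel_right) simp
qed

text \<open>
  The reflection along \<open>u - v\<close> fixes the axis and takes \<open>u\<close> to \<open>v\<close>, but reverses orientation. The
  reflection in the plane spanned by \<open>a\<close> and \<open>u\<close>, applied first, repairs this and moves neither \<open>a\<close> nor \<open>u\<close>.
\<close>

lemma rotation_about_axis_exists:
  fixes a u v :: "real^3"
  assumes a: "norm a = 1" and uv: "norm u = norm v" and au: "a \<bullet> u = a \<bullet> v"
  obtains A where "rotation_matrix A" and "A *v a = a" and "A *v u = v"
proof (cases "u = v")
  case True
  then show ?thesis using that[of "mat 1"] by (simp add: rotation_matrix_def orthogonal_matrix_id)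
next
  case False
  define n where "n = u - v"
  define m where "m = cross3 a u"
  have n: "n \<noteq> 0" "n \<bullet> a = 0" using False au by (simp_all add: n_def inner_diff_left inner_diff_right inner_commute)
  have m: "m \<bullet> a = 0" "m \<bullet> u = 0" by (simp_all add: m_def dot_cross_self)
  have "m \<noteq> 0"
  proof
    assume "m = 0"
    have proj: "x = (a \<bullet> x) *\<^sub>R a" if "(a \<bullet> x)\<^sup>2 = (norm x)\<^sup>2" for x
    proof -
      have "(norm (x - (a \<bullet> x) *\<^sub>R a))\<^sup>2 = (norm x)\<^sup>2 - (a \<bullet> x)\<^sup>2"
        using a unfolding power2_norm_eq_inner
        by (simp add: inner_diff_left inner_diff_right inner_commute norm_eq_1 power2_eq_square)
      then show ?thesis using that by simp
    qed
    have "(a \<bullet> u)\<^sup>2 = (norm u)\<^sup>2" using norm_cross_dot[of a u] \<open>m = 0\<close> a by (simp add: m_def)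
    then have "u = v" using proj[of u] proj[of v] uv au by simp
    then show False using False by simp
  qed
  let ?f = "reflection n" and ?g = "reflection m"
  have lin: "linear ?f" "linear ?g"
    using orthogonal_transformation_reflection orthogonal_transformation_linear by blast+
  define A where "A = matrix ?f ** matrix ?g"
  have A: "A *v x = ?f (?g x)" for x
    using lin by (simp add: A_def matrix_vector_mul_assoc[symmetric] matrix_works)
  have fix_a: "?f a = a" "?g a = a" "?g u = u" using n m by (simp_all add: reflection_def)
  have "?f u = v"
  proof -
    have "n \<bullet> n = 2 * (n \<bullet> u)"
      using uv unfolding n_def norm_eq by (simp add: inner_diff_left inner_diff_right inner_commute)
    moreover have "n \<bullet> n \<noteq> 0" using n(1) by simp
    ultimately have "2 * (n \<bullet> u) / (n \<bullet> n) = 1" by (metis divide_self)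
    then have "reflection n u = u - n" by (simp only: reflection_def scaleR_one)
    then show ?thesis by (simp add: n_def)
  qed
  moreover have "rotation_matrix A"
    unfolding rotation_matrix_def
  proof
    show "orthogonal_matrix A"
      unfolding A_def using orthogonal_transformation_reflection orthogonal_transformation_matrix
      by (blast intro: orthogonal_matrix_mul)
    show "det A = 1"
      using det_reflection[OF n(1) a n(2)] det_reflection[OF \<open>m \<noteq> 0\<close> a m(1)] by (simp add: A_def det_mul)
  qed
  ultimately show ?thesis using that[of A] A fix_a by simp
qed

lemma plane_orthonormal_frame:
  assumes "plane P" "line_through x0 y0 \<subseteq> P" and y0: "norm y0 = 1"
  obtains e where "norm e = 1" and "y0 \<bullet> e = 0" and "\<And>\<alpha> \<beta>. x0 + \<alpha> *\<^sub>R y0 + \<beta> *\<^sub>R e \<in> P"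
proof -
  have P: "affine P" "aff_dim P = 2" using assms(1) by (auto simp: plane_def)
  have line: "line_through x0 y0 = affine hull {x0, x0 + y0}"
    by (simp add: line_through_def affine_hull_2_alt)
  have "aff_dim (line_through x0 y0) = 1"
    unfolding line aff_dim_affine_hull using y0 by (auto simp: aff_dim_2)
  then have "line_through x0 y0 \<noteq> P" using P(2) by auto
  then obtain z where z: "z \<in> P" "z \<notin> line_through x0 y0"
    using assms(2) by blast
  have onP: "x0 + s *\<^sub>R y0 \<in> P" for s using assms(2) by (auto simp: line_through_def)
  define s where "s = y0 \<bullet> (z - x0)"
  define d where "d = z - (x0 + s *\<^sub>R y0)"
  have d0: "d \<noteq> 0" using z(2) by (auto simp: d_def line_through_def)
  have "y0 \<bullet> d = 0"
    using y0 by (simp add: d_def s_def inner_diff_right inner_add_right norm_eq_1)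
  moreover have "x0 + \<alpha> *\<^sub>R y0 + \<beta> *\<^sub>R (d /\<^sub>R norm d) \<in> P" for \<alpha> \<beta>
    using mem_affine_3_minus[OF P(1) onP[of \<alpha>] z(1) onP[of s], of "\<beta> / norm d"]
    by (simp add: d_def divide_inverse)
  ultimately show thesis using that[of "d /\<^sub>R norm d"] d0 by simp
qed

section \<open>Curves and controls\<close>

lemma AE_lebesgue_on_interval_iff:
  fixes a b :: real
  shows "(AE t in lebesgue_on {a..b}. P t) \<longleftrightarrow> (\<exists>N. negligible N \<and> (\<forall>t\<in>{a..b} - N. P t))"
proof -
  have "(AE t in lebesgue_on {a..b}. P t) \<longleftrightarrow> (AE t in lebesgue. t \<in> {a..b} \<longrightarrow> P t)"
    by (rule AE_restrict_space_iff) simp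
  also have "\<dots> \<longleftrightarrow> (\<exists>N. negligible N \<and> (\<forall>t\<in>{a..b} - N. P t))"
  proof -
    have "({x \<in> space lebesgue. \<not> (x \<in> {a..b} \<longrightarrow> P x)} \<subseteq> N) = (\<forall>t\<in>{a..b} - N. P t)" for N
      by auto
    then show ?thesis by (simp only: eventually_ae_filter negligible_iff_null_sets Bex_def)
  qed
  finally show ?thesis .
qed

lemma AE_lebesgue_on_interiorI:
  fixes a b :: real
  assumes "negligible N" and "\<And>t. t \<in> {a<..<b} - N \<Longrightarrow> P t"
  shows "AE t in lebesgue_on {a..b}. P t"
proof -
  have "negligible (N \<union> {a, b})" using assms(1) by (intro negligible_Un) auto
  moreover have "P t" if "t \<in> {a..b} - (N \<union> {a, b})" for t
    by (rule assms(2)) (use that in auto)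
  ultimately show ?thesis unfolding AE_lebesgue_on_interval_iff by blast
qed

lemma curvature_bounded_curve_rotate:
  assumes curve: "curvature_bounded_curve x0 y0 T x y" and R: "R \<in> rotations_about (line_through x0 y0)"
  obtains x' y' where "curvature_bounded_curve x0 y0 T x' y'" and "x' T = R (x T)"
proof -
  obtain A b where A: "rotation_matrix A" and Rdef: "R = (\<lambda>p. A *v p + b)"
    and fixed: "\<And>p. p \<in> line_through x0 y0 \<Longrightarrow> R p = p"
    using R unfolding rotations_about_def by blast
  have "x0 + s *\<^sub>R y0 \<in> line_through x0 y0" for s by (auto simp: line_through_def)
  from this[of 0] this[of 1] have x0: "R x0 = x0" and "R (x0 + y0) = x0 + y0" using fixed by auto
  moreover have "A *v y0 = R (x0 + y0) - R x0" by (simp add: Rdef matrix_vector_right_distrib)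
  ultimately have y0: "A *v y0 = y0" by simp
  have "orthogonal_transformation ((*v) A)"
    using A by (simp add: rotation_matrix_def orthogonal_transformation_matrix matrix_of_matrix_vector_mul)
  then have nA: "norm (A *v v) = norm v" for v by (rule orthogonal_transformation_norm)
  have nA2: "norm (A *v u - A *v v) = norm (u - v)" for u v
    using nA[of "u - v"] by (simp add: matrix_vector_mult_diff_distrib)
  note deriv = bounded_linear.has_vector_derivative[OF matrix_vector_mul_bounded_linear]
  have "curvature_bounded_curve x0 y0 T (\<lambda>t. R (x t)) (\<lambda>t. A *v y t)"
    unfolding curvature_bounded_curve_def
  proof (intro conjI ballI)
    fix t assume "t \<in> {0..T}"
    then have "(x has_vector_derivative y t) (at t within {0..T})" and "norm (y t) = 1"
      using curve by (auto simp: curvature_bounded_curve_def)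
    then show "((\<lambda>t. R (x t)) has_vector_derivative A *v y t) (at t within {0..T})" "norm (A *v y t) = 1"
      using has_vector_derivative_add[OF deriv has_vector_derivative_const] by (auto simp: Rdef nA)
  next
    show "absolutely_continuous_on {0..T} (\<lambda>t. A *v y t)"
      using curve by (simp add: curvature_bounded_curve_def absolutely_continuous_on_def nA2)
    have "AE t in lebesgue_on {0..T}. \<exists>a. (y has_vector_derivative a) (at t within {0..T}) \<and> norm a \<le> 1"
      using curve by (simp add: curvature_bounded_curve_def)
    then show "AE t in lebesgue_on {0..T}. \<exists>a. ((\<lambda>t. A *v y t) has_vector_derivative a) (at t within {0..T}) \<and> norm a \<le> 1"
      by eventually_elim (metis deriv nA)
  qed (use curve x0 y0 in \<open>auto simp: curvature_bounded_curve_def\<close>)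
  then show thesis by (rule that) simp
qed

text \<open>
  The limit of the difference quotients is Borel measurable once \<open>y\<close> is extended continuously to the
  line by its boundary values; in the interior this does not affect the derivative.
\<close>

lemma measurable_interior_derivative:
  fixes y :: "real \<Rightarrow> 'a::{banach, second_countable_topology}"
  assumes "continuous_on {a..b} y"
  obtains z where "z \<in> borel_measurable borel"
    and "\<And>t d. \<lbrakk>t \<in> {a<..<b}; (y has_vector_derivative d) (at t)\<rbrakk> \<Longrightarrow> z t = d"
proof -
  define yc where "yc t = y (max a (min b t))" for t
  define q where "q n t = real (Suc n) *\<^sub>R (yc (t + 1 / real (Suc n)) - yc t)" for n t
  define z where "z t = lim (\<lambda>n. q n t)" for t
  show thesis
  proof (cases "a < b")
    case True
    have "continuous_on UNIV yc"
      unfolding yc_def by (rule continuous_on_compose2[OF assms]) (use True in \<open>auto intro!: continuous_intros\<close>)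
    moreover from this have "continuous_on UNIV (\<lambda>t. yc (t + 1 / real (Suc n)))" for n
      by (rule continuous_on_compose2) (auto intro!: continuous_on_add continuous_on_id continuous_on_const)
    ultimately have "continuous_on UNIV (q n)" for n
      unfolding q_def by (intro continuous_on_scaleR continuous_on_const continuous_on_diff)
    then have "q n \<in> borel_measurable borel" for n by (rule borel_measurable_continuous_onI)
    then have "z \<in> borel_measurable borel" unfolding z_def by (rule borel_measurable_lim_metric)
    moreover have "z t = d" if t: "t \<in> {a<..<b}" and d: "(y has_vector_derivative d) (at t)" for t d
    proof -
      have "(yc has_vector_derivative d) (at t)"
        by (rule has_vector_derivative_transform_within_open[OF d, of "{a<..<b}"]) (use t in \<open>auto simp: yc_def\<close>)
      then have "((\<lambda>s. (yc s - yc t - (s - t) *\<^sub>R d) /\<^sub>R norm (s - t)) \<longlongrightarrow> 0) (at t)"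
        by (simp add: has_vector_derivative_def has_derivative_at_within)
      moreover have "filterlim (\<lambda>n. t + 1 / real (Suc n)) (at t) sequentially"
      proof (rule filterlim_atI)
        show "(\<lambda>n. t + 1 / real (Suc n)) \<longlonglongrightarrow> t"
          using tendsto_add[OF tendsto_const LIMSEQ_inverse_real_of_nat, of t] by (simp add: inverse_eq_divide)
        show "\<forall>\<^sub>F n in sequentially. t + 1 / real (Suc n) \<noteq> t"
          by (rule always_eventually) (simp del: of_nat_Suc)
      qed
      ultimately have "(\<lambda>n. (yc (t + 1 / real (Suc n)) - yc t - (t + 1 / real (Suc n) - t) *\<^sub>R d)
          /\<^sub>R norm (t + 1 / real (Suc n) - t)) \<longlonglongrightarrow> 0"
        by (rule filterlim_compose)
      moreover have "(yc (t + 1 / real (Suc n)) - yc t - (t + 1 / real (Suc n) - t) *\<^sub>R d)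
          /\<^sub>R norm (t + 1 / real (Suc n) - t) = q n t - d" for n
        by (simp add: q_def scaleR_diff_right)
      ultimately have "(\<lambda>n. q n t - d) \<longlonglongrightarrow> 0" by simp
      then have "(\<lambda>n. q n t) \<longlonglongrightarrow> d" by (rule LIM_zero_cancel)
      then show ?thesis by (simp add: z_def limI)
    qed
    ultimately show thesis by (rule that)
  next
    case False
    then show thesis using that[of "\<lambda>_. 0"] by auto
  qed
qed

text \<open>
  The control is \<open>cross3 a y\<close> for the acceleration \<open>a\<close>: since \<open>a\<close> is orthogonal to the unit vector \<open>y\<close>, the
  product \<open>cross3 y (cross3 a y)\<close> is \<open>a\<close> again.
\<close>

lemma curvature_bounded_curve_reachable:
  assumes "0 < T" and curve: "curvature_bounded_curve x0 y0 T x y"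
  shows "(x T, y T) \<in> \<G>\<^sub>3 x0 y0 T"
proof -
  have x': "\<And>t. t \<in> {0..T} \<Longrightarrow> (x has_vector_derivative y t) (at t within {0..T})"
    and unit: "\<And>t. t \<in> {0..T} \<Longrightarrow> norm (y t) = 1"
    and ac: "absolutely_continuous_on {0..T} y" and init: "x 0 = x0" "y 0 = y0"
    using curve by (auto simp: curvature_bounded_curve_def)
  obtain N where N: "negligible N"
      "\<And>t. t \<in> {0..T} - N \<Longrightarrow> \<exists>a. (y has_vector_derivative a) (at t within {0..T}) \<and> norm a \<le> 1"
    using curve unfolding curvature_bounded_curve_def AE_lebesgue_on_interval_iff by blast
  have "1-lipschitz_on {0..T} y"
  proof (rule absolutely_continuous_imp_lipschitz[OF ac N(1)])
    show "\<exists>a. (y has_vector_derivative a) (at t) \<and> norm a \<le> 1" if "t \<in> {0<..<T} - N" for t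
      using N(2)[of t] that by (auto simp: at_within_Icc_at)
  qed simp
  then have conty: "continuous_on {0..T} y" by (rule lipschitz_on_continuous_on)
  obtain z where z: "z \<in> borel_measurable borel"
      "\<And>t d. \<lbrakk>t \<in> {0<..<T}; (y has_vector_derivative d) (at t)\<rbrakk> \<Longrightarrow> z t = d"
    using measurable_interior_derivative[OF conty] by metis
  define v where "v t = cross3 (z t) (y t)" for t
  \<comment> \<open>On the null set where \<open>v\<close> may be large, any admissible value serves.\<close>
  define w where "w t = (if norm (v t) \<le> 1 then v t else 0)" for t
  have "y \<in> borel_measurable (lebesgue_on {0..T})"
    by (rule continuous_imp_measurable_on_sets_lebesgue[OF conty]) simp
  moreover have "z \<in> borel_measurable (lebesgue_on {0..T})"
    using z(1) by (intro measurable_restrict_space1 measurable_completion) simp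
  moreover have "continuous_on UNIV (\<lambda>p::(real^3) \<times> (real^3). cross3 (fst p) (snd p))"
    by (rule continuous_on_cross[OF continuous_on_fst[OF continuous_on_id] continuous_on_snd[OF continuous_on_id]])
  ultimately have "v \<in> borel_measurable (lebesgue_on {0..T})"
    unfolding v_def by (intro borel_measurable_continuous_Pair[where H = cross3])
  then have "w \<in> borel_measurable (lebesgue_on {0..T})"
    unfolding w_def by measurable
  then have "admissible_control T w" by (auto simp: admissible_control_def w_def)
  moreover have "trajectory x0 y0 T w x y"
    unfolding trajectory_def
  proof (intro conjI ballI)
    have "1-lipschitz_on {0..T} x"
    proof (rule bounded_derivative_imp_lipschitz)
      fix t assume t: "t \<in> {0..T}"
      show "(x has_derivative (\<lambda>h. h *\<^sub>R y t)) (at t within {0..T})"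
        using x'[OF t] by (simp add: has_vector_derivative_def)
      show "onorm (\<lambda>h. h *\<^sub>R y t) \<le> 1"
        by (rule onorm_bound) (use unit[OF t] in auto)
    qed auto
    then show "absolutely_continuous_on {0..T} x" by (rule lipschitz_imp_absolutely_continuous)
    have "(y has_vector_derivative cross3 (y t) (w t)) (at t)" 
      if t: "t \<in> {0<..<T} - N" for t
    proof -
      obtain d where d: "(y has_vector_derivative d) (at t)" "norm d \<le> 1"
        using N(2)[of t] t by (auto simp: at_within_Icc_at)
      have yd: "y t \<bullet> d = 0"
        by (rule unit_speed_derivative_orthogonal[OF _ _ _ d(1), of "{0<..<T}"]) (use t unit in auto)
      have yt: "norm (y t) = 1" using unit t by simp
      have vt: "v t = cross3 d (y t)" using z(2)[OF _ d(1)] t by (simp add: v_def)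
      have "norm (v t) \<le> 1"
        using norm_cross_dot[of d "y t"] yd yt d(2) by (simp add: vt inner_commute)
      moreover have "cross3 (y t) (v t) = d"
        using yd yt by (simp add: vt Lagrange norm_eq_1)
      ultimately show ?thesis using d(1) by (simp add: w_def)
    qed
    then show "AE t in lebesgue_on {0..T}. (x has_vector_derivative y t) (at t within {0..T}) \<and>
        (y has_vector_derivative cross3 (y t) (w t)) (at t within {0..T})"
    proof (intro AE_lebesgue_on_interiorI[OF N(1)] conjI)
      show "(x has_vector_derivative y t) (at t within {0..T})" if "t \<in> {0<..<T} - N" for t
        by (rule x') (use that in auto)
    qed (rule has_vector_derivative_at_within)
  qed (use ac unit init in auto)
  ultimately show ?thesis unfolding \<G>\<^sub>3_def by blast
qed

text \<open>
  The difference of the position and the integral of the velocity is absolutely continuous with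
  derivative zero almost everywhere, so it is Lipschitz with constant zero.
\<close>

lemma trajectory_velocity:
  assumes "0 < T" and traj: "trajectory x0 y0 T w x y" and w: "admissible_control T w"
  shows "unit_velocity 0 T y" and "x T = x0 + integral {0..T} y"
proof -
  have ac: "absolutely_continuous_on {0..T} x" "absolutely_continuous_on {0..T} y"
    and unit: "\<And>t. t \<in> {0..T} \<Longrightarrow> norm (y t) = 1" and init: "x 0 = x0"
    using traj by (auto simp: trajectory_def)
  obtain N where N: "negligible N" "\<And>t. t \<in> {0..T} - N \<Longrightarrow> (x has_vector_derivative y t) (at t within {0..T}) \<and>
        (y has_vector_derivative cross3 (y t) (w t)) (at t within {0..T})"
    using traj unfolding trajectory_def AE_lebesgue_on_interval_iff by blast
  have x': "(x has_vector_derivative y t) (at t)" and y': "(y has_vector_derivative cross3 (y t) (w t)) (at t)"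
    if "t \<in> {0<..<T} - N" for t
    using N(2)[of t] that by (auto simp: at_within_Icc_at)
  have lipy: "1-lipschitz_on {0..T} y"
  proof (rule absolutely_continuous_imp_lipschitz[OF ac(2) N(1)])
    fix t assume t: "t \<in> {0<..<T} - N"
    have "(norm (cross3 (y t) (w t)))\<^sup>2 \<le> (norm (y t) * norm (w t))\<^sup>2"
      using norm_cross_dot[of "y t" "w t"] by (smt (verit) zero_le_power2)
    moreover have "norm (y t) = 1" using unit t by simp
    ultimately have "(norm (cross3 (y t) (w t)))\<^sup>2 \<le> (norm (w t))\<^sup>2" by simp
    then have "norm (cross3 (y t) (w t)) \<le> norm (w t)" by (rule power2_le_imp_le) simp
    also have "\<dots> \<le> 1" using w t by (simp add: admissible_control_def)
    finally have "norm (cross3 (y t) (w t)) \<le> 1" .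
    then show "\<exists>a. (y has_vector_derivative a) (at t) \<and> norm a \<le> 1" using y'[OF t] by blast
  qed simp
  show y: "unit_velocity 0 T y"
    unfolding unit_velocity_def using lipy unit N(1) y' differentiableI_vector by blast
  note conty = unit_velocityD(3)[OF y]
  have lipx: "1-lipschitz_on {0..T} x"
    by (rule absolutely_continuous_imp_lipschitz[OF ac(1) N(1)]) (use x' unit in \<open>fastforce+\<close>)
  have "1-lipschitz_on {0..T} (\<lambda>t. integral {0..t} y)"
  proof (rule bounded_derivative_imp_lipschitz)
    fix t assume t: "t \<in> {0..T}"
    show "((\<lambda>t. integral {0..t} y) has_derivative (\<lambda>h. h *\<^sub>R y t)) (at t within {0..T})"
      using integral_has_vector_derivative[OF conty t] by (simp add: has_vector_derivative_def)
    show "onorm (\<lambda>h. h *\<^sub>R y t) \<le> 1"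
      by (rule onorm_bound) (use unit[OF t] in auto)
  qed auto
  from lipschitz_on_diff[OF lipx this]
  have ac': "absolutely_continuous_on {0..T} (\<lambda>t. x t - integral {0..t} y)"
    by (rule lipschitz_imp_absolutely_continuous)
  have "0-lipschitz_on {0..T} (\<lambda>t. x t - integral {0..t} y)"
  proof (rule absolutely_continuous_imp_lipschitz[OF ac' N(1)])
    fix t assume t: "t \<in> {0<..<T} - N"
    then have "((\<lambda>t. x t - integral {0..t} y) has_vector_derivative (y t - y t)) (at t)"
      by (intro has_vector_derivative_diff x' integral_has_vector_derivative_interior[OF conty]) auto
    then show "\<exists>a. ((\<lambda>t. x t - integral {0..t} y) has_vector_derivative a) (at t) \<and> norm a \<le> 0" by auto
  qed simp
  from lipschitz_onD[OF this, of T 0] show "x T = x0 + integral {0..T} y"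
    using \<open>0 < T\<close> init by (simp add: diff_eq_eq add.commute)
qed

text \<open>
  The velocity is developed into the complex plane, and the complex plane is laid isometrically onto
  the direction space of \<open>P\<close> with \<open>1\<close> going to \<open>y0\<close>. The displacement of the resulting planar curve has the
  same norm and the same component along \<open>y0\<close> as that of the given trajectory, hence the two differ by
  a rotation about the axis.
\<close>

lemma reachable_imp_rotated_planar:
  fixes x0 y0 :: "real^3"
  assumes y0: "norm y0 = 1" and "0 < T" and P: "plane P" "line_through x0 y0 \<subseteq> P"
    and w: "admissible_control T w" and traj: "trajectory x0 y0 T w x y"
  obtains R p where "R \<in> rotations_about (line_through x0 y0)" and "p \<in> fst ` \<G>\<^sub>2 P x0 y0 T" and "x T = R p"
proof -
  obtain e where e: "norm e = 1" "y0 \<bullet> e = 0" and inP: "\<And>\<alpha> \<beta>. x0 + \<alpha> *\<^sub>R y0 + \<beta> *\<^sub>R e \<in> P"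
    using plane_orthonormal_frame[OF P y0] by metis
  define V where "V = integral {0..T} y"
  have "y 0 = y0" using traj by (simp add: trajectory_def)
  then obtain h :: "real \<Rightarrow> complex" where h: "unit_velocity 0 T h" "h 0 = 1"
    "norm (integral {0..T} h) = norm V" "Re (integral {0..T} h) = y0 \<bullet> V"
    using planar_development[OF \<open>0 < T\<close> trajectory_velocity(1)[OF \<open>0 < T\<close> traj w]] unfolding V_def by metis
  note hD = unit_velocityD[OF h(1)]
  define J where "J z = Re z *\<^sub>R y0 + Im z *\<^sub>R e" for z
  have J: "bounded_linear J"
    unfolding J_def by (intro bounded_linear_add bounded_linear_scaleR_const bounded_linear_Re bounded_linear_Im)
  have normJ: "norm (J z) = norm z" for z
  proof -
    have "(norm (J z))\<^sup>2 = (norm z)\<^sup>2"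
      unfolding cmod_power2 power2_norm_eq_inner J_def using e y0
      by (simp add: inner_add_left inner_add_right norm_eq_1 inner_commute power2_eq_square)
    then show ?thesis by simp
  qed
  define v where "v t = J (h t)" for t
  have lipv: "1-lipschitz_on {0..T} v"
    using hD(1) normJ unfolding v_def lipschitz_on_def dist_norm
    by (simp flip: linear_diff[OF bounded_linear.linear[OF J]])
  have contv: "continuous_on {0..T} v" using lipv by (rule lipschitz_on_continuous_on)
  have int: "integral {0..t} v = J (integral {0..t} h)" if "t \<in> {0..T}" for t
  proof -
    have "h integrable_on {0..t}"
      using hD(3) that by (intro integrable_continuous_real) (auto elim: continuous_on_subset)
    from integral_linear[OF this J] show ?thesis by (simp add: v_def[abs_def] o_def)
  qed
  define c where "c t = x0 + integral {0..t} v" for t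
  have "curvature_bounded_curve x0 y0 T c v"
    unfolding curvature_bounded_curve_def
  proof (intro conjI ballI)
    fix t assume t: "t \<in> {0..T}"
    show "(c has_vector_derivative v t) (at t within {0..T})"
      using has_vector_derivative_add[OF has_vector_derivative_const integral_has_vector_derivative[OF contv t]]
      by (simp add: c_def[abs_def])
    show "norm (v t) = 1" using hD(2)[OF t] by (simp add: v_def normJ)
  next
    show "absolutely_continuous_on {0..T} v" using lipv by (rule lipschitz_imp_absolutely_continuous)
    obtain N where N: "negligible N" "\<And>t. t \<in> {0<..<T} - N \<Longrightarrow> h differentiable (at t)"
      using h(1) unfolding unit_velocity_def by blast
    have "\<exists>a. (v has_vector_derivative a) (at t within {0..T}) \<and> norm a \<le> 1" if t: "t \<in> {0<..<T} - N" for t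
    proof -
      obtain a where "(h has_vector_derivative a) (at t)" using N(2)[OF t] vector_derivative_works by blast
      then have "(v has_vector_derivative J a) (at t)"
        unfolding v_def by (rule bounded_linear.has_vector_derivative[OF J])
      moreover from this have "norm (J a) \<le> 1"
        by (rule vector_derivative_norm_le_lipschitz[OF lipschitz_on_subset[OF lipv, of "{0<..<T}"] _ _, rotated 3])
          (use t in auto)
      ultimately show ?thesis using has_vector_derivative_at_within by blast
    qed
    then show "AE t in lebesgue_on {0..T}. \<exists>a. (v has_vector_derivative a) (at t within {0..T}) \<and> norm a \<le> 1"
      by (rule AE_lebesgue_on_interiorI[OF N(1)])
  qed (use h(2) in \<open>simp_all add: c_def v_def J_def\<close>)
  moreover have "c t \<in> P" if "t \<in> {0..T}" for t
    using int[OF that] inP by (simp add: c_def J_def add.assoc)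
  ultimately have "(c T, v T) \<in> \<G>\<^sub>2 P x0 y0 T" unfolding \<G>\<^sub>2_def by blast
  then have "c T \<in> fst ` \<G>\<^sub>2 P x0 y0 T" by force
  moreover obtain A where A: "rotation_matrix A" "A *v y0 = y0" "A *v J (integral {0..T} h) = V"
  proof (rule rotation_about_axis_exists[OF y0])
    show "norm (J (integral {0..T} h)) = norm V" by (simp add: normJ h(3))
    show "y0 \<bullet> J (integral {0..T} h) = y0 \<bullet> V"
      using e y0 h(4) by (simp add: J_def inner_add_right norm_eq_1)
  qed
  define R where "R p = A *v p + (x0 - A *v x0)" for p
  have "R p = p" if "p \<in> line_through x0 y0" for p
    using that A(2) by (auto simp: R_def line_through_def matrix_vector_right_distrib matrix_vector_mult_scaleR)
  then have "R \<in> rotations_about (line_through x0 y0)"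
    using A(1) unfolding rotations_about_def R_def by blast
  moreover have "x T = R (c T)"
    using trajectory_velocity(2)[OF \<open>0 < T\<close> traj w] int[of T] \<open>0 < T\<close> A(3)
    by (simp add: R_def c_def V_def matrix_vector_right_distrib)
  ultimately show thesis using that by blast
qed

section \<open>Spatial and planar reachable positions\<close>

theorem theorem11:
  fixes x0 y0 :: "real^3" and t\<^sub>f :: real and P :: "(real^3) set"
  assumes "norm y0 = 1"
    and "t\<^sub>f > 0"
    and "plane P"
    and "line_through x0 y0 \<subseteq> P"
  shows "fst ` \<G>\<^sub>3 x0 y0 t\<^sub>f =
           (\<Union>R\<in>rotations_about (line_through x0 y0). R ` (fst ` \<G>\<^sub>2 P x0 y0 t\<^sub>f))"
proof (intro equalityI subsetI)
  fix p assume "p \<in> fst ` \<G>\<^sub>3 x0 y0 t\<^sub>f"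
  then obtain x y w where w: "admissible_control t\<^sub>f w" and traj: "trajectory x0 y0 t\<^sub>f w x y" and p: "p = x t\<^sub>f"
    unfolding \<G>\<^sub>3_def by auto
  obtain R q where "R \<in> rotations_about (line_through x0 y0)" "q \<in> fst ` \<G>\<^sub>2 P x0 y0 t\<^sub>f" "p = R q"
    using reachable_imp_rotated_planar[OF assms w traj] p by blast
  then show "p \<in> (\<Union>R\<in>rotations_about (line_through x0 y0). R ` (fst ` \<G>\<^sub>2 P x0 y0 t\<^sub>f))"
    by blast
next
  fix p assume "p \<in> (\<Union>R\<in>rotations_about (line_through x0 y0). R ` (fst ` \<G>\<^sub>2 P x0 y0 t\<^sub>f))"
  then obtain R x y where R: "R \<in> rotations_about (line_through x0 y0)"
    and curve: "curvature_bounded_curve x0 y0 t\<^sub>f x y" and p: "p = R (x t\<^sub>f)"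
    unfolding \<G>\<^sub>2_def by auto
  obtain x' y' where "curvature_bounded_curve x0 y0 t\<^sub>f x' y'" "x' t\<^sub>f = p"
    using curvature_bounded_curve_rotate[OF curve R] p by metis
  then show "p \<in> fst ` \<G>\<^sub>3 x0 y0 t\<^sub>f"
    using curvature_bounded_curve_reachable[OF assms(2)] by force
qed

end
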